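(* Let $\sigma_{\rm imp}(\kappa,t)$ be the implied volatility of the model described in the context, and for $T,M\in(0,\infty)$ let $$\mathcal{A}_{T,M}:=\big\{(\kappa,t)\in\mathbb{R}^2:\ 0<t<T,\ \kappa>M\,\boldsymbol{\kappa}_2(\mathsf{c}^{1/D}t)\big\}.$$ Fix $T>0$. For every $\epsilon>0$ there exists $M=M(T,\epsilon)>0$ such that for all $(\kappa,t)\in\mathcal{A}_{T,M}$ $$(1-\epsilon)\sqrt{\frac{\mathsf{c}^{1/D}}{2\mathsf{C}}}\left(\frac{\frac{\kappa}{\mathsf{c}^{1/D}t}}{\sqrt{\log\frac{\kappa}{\mathsf{c}^{1/D}t}}}\right)^{\frac{1/2-D}{1-D}}\le\sigma_{\rm imp}(\kappa,t)\le(1+\epsilon)\sqrt{\frac{\mathsf{c}^{1/D}}{2\mathsf{C}}}\left(\frac{\frac{\kappa}{\mathsf{c}^{1/D}t}}{\sqrt{\log\frac{\kappa}{\mathsf{c}^{1/D}t}}}\right)^{\frac{1/2-D}{1-D}}.$$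
   Context: Model. Fix real parameters $0<D<\frac12$, $V>0$, $\lambda>0$, $\tau_0<0$. Let $(N_t)_{t\ge0}$ be a Poisson process of intensity $\lambda$ with jump times $0<\tau_1<\tau_2<\dots$. Set $$\mathsf{c}:=\frac{\lambda^{D-\frac12}V}{\sqrt{\Gamma(2D+1)}},\qquad I_t:=\mathsf{c}^2\Big\{(t-\tau_{N_t})^{2D}-(-\tau_0)^{2D}+\sum_{k=1}^{N_t}(\tau_k-\tau_{k-1})^{2D}\Big\}$$ (the sum is $0$ if $N_t=0$). Let $(W_t)_{t\ge0}$ be a standard Brownian motion independent of $(I_t)_{t\ge 0}$. The (risk-neutral) log-price is $X_t:=W_{I_t}-\frac12I_t$. Option price and implied volatility. The call price is $c(\kappa,t):=\mathrm{E}[(e^{X_t}-e^\kappa)^+]$. The Black–Scholes price is $C_{BS}(\kappa,v):=\mathrm{E}[(e^{W_{v^2}-\frac12v^2}-e^\kappa)^+]$. For $t>0$, $\kappa\in\mathbb{R}$, the implied volatility $\sigma_{\rm imp}(\kappa,t)$ is the unique $\sigma\in(0,\infty)$ with $c(\kappa,t)=C_{BS}(\kappa,\sigma\sqrt t)$. Auxiliary function and constant. The function $\boldsymbol{\kappa}_2:(0,1)\to(0,\infty)$ is defined by $\boldsymbol{\kappa}_2(t):=t^D\sqrt{\log\frac1t}$. Also $\mathsf{C}:=(1-D)^{\frac{1/2}{1-D}}\big/(\frac12-D)^{\frac{1/2-D}{1-D}}$.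
   Formalization: Proved for T with c^{1/D}T < 1 instead of every T > 0: κ_2 is defined only on (0,1), and for c^{1/D}T = 1 the claim fails, since κ_2(c^{1/D}t) → 0 as t → T lets log(κ/(c^{1/D}t)) reach 0 on every A_{T,M}. *)

theory Defs
  imports "HOL-Probability.Probability"
begin

text \<open>
  Stochastic processes are functions \<open>real \<Rightarrow> 'a \<Rightarrow> 'b\<close> of which only the times \<open>t \<ge> 0\<close> matter;
  path properties hold for every \<open>\<omega> \<in> space P\<close>.
\<close>

definition independent_increments ::
    "'a measure \<Rightarrow> 'b measure \<Rightarrow> (real \<Rightarrow> 'a \<Rightarrow> 'b::minus) \<Rightarrow> bool" where
  "independent_increments P S X \<longleftrightarrow>
     (\<forall>n (s :: nat \<Rightarrow> real). 0 \<le> s 0 \<and> mono_on {..n} s \<longrightarrow>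
        prob_space.indep_vars P (\<lambda>_. S) (\<lambda>i \<omega>. X (s (Suc i)) \<omega> - X (s i) \<omega>) {..<n})"

text \<open>The subtraction of naturals is exact here, since the paths are nondecreasing.\<close>

definition poisson_process :: "'a measure \<Rightarrow> real \<Rightarrow> (real \<Rightarrow> 'a \<Rightarrow> nat) \<Rightarrow> bool" where
  "poisson_process P lam N \<longleftrightarrow>
     (\<forall>t\<ge>0. N t \<in> measurable P (count_space UNIV)) \<and>
     (\<forall>\<omega>\<in>space P. N 0 \<omega> = 0 \<and> mono_on {0..} (\<lambda>t. N t \<omega>) \<and>
        (\<forall>t\<ge>0. continuous (at_right t) (\<lambda>s. N s \<omega>))) \<and>
     independent_increments P (count_space UNIV) N \<and>
     (\<forall>s t. 0 \<le> s \<and> s < t \<longrightarrow>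
        distr P (count_space UNIV) (\<lambda>\<omega>. N t \<omega> - N s \<omega>) = measure_pmf (poisson_pmf (lam * (t - s))))"

definition brownian_motion :: "'a measure \<Rightarrow> (real \<Rightarrow> 'a \<Rightarrow> real) \<Rightarrow> bool" where
  "brownian_motion P W \<longleftrightarrow>
     (\<forall>t\<ge>0. W t \<in> borel_measurable P) \<and>
     (\<forall>\<omega>\<in>space P. W 0 \<omega> = 0 \<and> continuous_on {0..} (\<lambda>t. W t \<omega>)) \<and>
     independent_increments P borel W \<and>
     (\<forall>s t. 0 \<le> s \<and> s < t \<longrightarrow>
        distributed P lborel (\<lambda>\<omega>. W t \<omega> - W s \<omega>) (normal_density 0 (sqrt (t - s))))"

definition independent_processes ::
    "'a measure \<Rightarrow> (real \<Rightarrow> 'a \<Rightarrow> real) \<Rightarrow> (real \<Rightarrow> 'a \<Rightarrow> real) \<Rightarrow> bool" where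
  "independent_processes P X Y \<longleftrightarrow>
     prob_space.indep_var P
       (PiM {0..} (\<lambda>_. borel)) (\<lambda>\<omega>. \<lambda>t\<in>{0..}. X t \<omega>)
       (PiM {0..} (\<lambda>_. borel)) (\<lambda>\<omega>. \<lambda>t\<in>{0..}. Y t \<omega>)"

text \<open>
  The parameter \<open>tau0 < 0\<close> is placed at index \<open>0\<close>; for \<open>k \<ge> 1\<close> this is the \<open>k\<close>-th jump time of
  \<open>N\<close> (the infimum is attained by right-continuity).
\<close>

definition jump_time :: "real \<Rightarrow> (real \<Rightarrow> 'a \<Rightarrow> nat) \<Rightarrow> nat \<Rightarrow> 'a \<Rightarrow> real" where
  "jump_time tau0 N k \<omega> = (if k = 0 then tau0 else Inf {t. 0 \<le> t \<and> k \<le> N t \<omega>})"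

definition c_const :: "real \<Rightarrow> real \<Rightarrow> real \<Rightarrow> real" where
  "c_const D V lam = lam powr (D - 1/2) * V / sqrt (Gamma (2 * D + 1))"

definition C_const :: "real \<Rightarrow> real" where
  "C_const D = (1 - D) powr ((1/2) / (1 - D)) / (1/2 - D) powr ((1/2 - D) / (1 - D))"

definition time_change ::
    "real \<Rightarrow> real \<Rightarrow> real \<Rightarrow> real \<Rightarrow> (real \<Rightarrow> 'a \<Rightarrow> nat) \<Rightarrow> real \<Rightarrow> 'a \<Rightarrow> real" where
  "time_change D V lam tau0 N t \<omega> =
     (c_const D V lam)\<^sup>2 *
       ((t - jump_time tau0 N (N t \<omega>) \<omega>) powr (2 * D) - (- tau0) powr (2 * D) +
        (\<Sum>k=1..N t \<omega>. (jump_time tau0 N k \<omega> - jump_time tau0 N (k - 1) \<omega>) powr (2 * D)))"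

definition log_price :: "(real \<Rightarrow> 'a \<Rightarrow> real) \<Rightarrow> (real \<Rightarrow> 'a \<Rightarrow> real) \<Rightarrow> real \<Rightarrow> 'a \<Rightarrow> real" where
  "log_price W I t \<omega> = W (I t \<omega>) \<omega> - I t \<omega> / 2"

definition call_price :: "'a measure \<Rightarrow> (real \<Rightarrow> 'a \<Rightarrow> real) \<Rightarrow> real \<Rightarrow> real \<Rightarrow> real" where
  "call_price P X \<kappa> t = (\<integral>\<omega>. max 0 (exp (X t \<omega>) - exp \<kappa>) \<partial>P)"

definition C_BS :: "'a measure \<Rightarrow> (real \<Rightarrow> 'a \<Rightarrow> real) \<Rightarrow> real \<Rightarrow> real \<Rightarrow> real" where
  "C_BS P W \<kappa> v = (\<integral>\<omega>. max 0 (exp (W (v\<^sup>2) \<omega> - v\<^sup>2 / 2) - exp \<kappa>) \<partial>P)"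

definition implied_volatility ::
    "'a measure \<Rightarrow> (real \<Rightarrow> 'a \<Rightarrow> real) \<Rightarrow> (real \<Rightarrow> 'a \<Rightarrow> real) \<Rightarrow> real \<Rightarrow> real \<Rightarrow> real" where
  "implied_volatility P W X \<kappa> t =
     (THE \<sigma>. 0 < \<sigma> \<and> call_price P X \<kappa> t = C_BS P W \<kappa> (\<sigma> * sqrt t))"

text \<open>Meaningful for \<open>0 < t < 1\<close> only.\<close>

definition kappa2 :: "real \<Rightarrow> real \<Rightarrow> real" where
  "kappa2 D t = t powr D * sqrt (ln (1 / t))"

definition A_set :: "real \<Rightarrow> real \<Rightarrow> real \<Rightarrow> real \<Rightarrow> (real \<times> real) set" where
  "A_set D c T M = {(\<kappa>, t). 0 < t \<and> t < T \<and> \<kappa> > M * kappa2 D (c powr (1 / D) * t)}"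

definition smile_asymptote :: "real \<Rightarrow> real \<Rightarrow> real \<Rightarrow> real \<Rightarrow> real" where
  "smile_asymptote D c \<kappa> t =
     sqrt (c powr (1 / D) / (2 * C_const D)) *
     ((\<kappa> / (c powr (1 / D) * t)) / sqrt (ln (\<kappa> / (c powr (1 / D) * t))))
       powr ((1/2 - D) / (1 - D))"

end

theory Submission
  imports Defs "HOL-Real_Asymp.Real_Asymp"
begin

text \<open>
  Conditionally on the clock \<open>I t\<close> the model is a Black-Scholes model with total variance \<open>I t\<close>, so the
  call price is the expectation of the Black-Scholes price \<open>bs_price \<kappa> (sqrt (I t))\<close>
  (\<open>call_price_time_changed\<close>). For large strikes this expectation is governed by the cheapest way to
  reach the strike, which combines two rare events. An unusually large number \<open>n\<close> of jumps, nearly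
  equally spaced, makes the clock as large as \<open>c\<^sup>2 * n powr (1 - 2 * D) * t powr (2 * D)\<close>, with
  negative log-probability of about \<open>n * ln (n / t)\<close>; given the clock, the Brownian motion reaches \<open>\<kappa>\<close>
  with negative log-probability of about \<open>\<kappa>\<^sup>2 / (2 * I t)\<close>. In the scaled variables \<open>s = c powr (1/D) * t\<close>,
  \<open>x = \<kappa> / s\<close> and \<open>n = s * m\<close> the sum of both is \<open>s * (m * ln m + x\<^sup>2 / (2 * m powr (1 - 2 * D)))\<close>.
  Minimising over \<open>m\<close> gives \<open>jump_rate\<close> and the minimal cost \<open>R\<close>, called \<open>path_cost\<close>. A
  Black-Scholes price with total volatility \<open>v\<close> has the exponent \<open>\<kappa>\<^sup>2 / (2 * v\<^sup>2)\<close>; equating it with \<open>R\<close>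
  gives \<open>v = \<kappa> / sqrt (2 * R)\<close>, which is the asserted asymptote times \<open>sqrt t\<close>
  (\<open>smile_asymptote_times_sqrt\<close>).

  The upper bound for the call price is a Chernoff bound (\<open>call_price_le\<close>): by concavity the clock is
  largest for equal gaps, so the conditional price is bounded by a function of the number of jumps,
  whose exponent is replaced by its tangent at the optimal number. The lower bound (\<open>call_price_ge\<close>)
  restricts to paths with one jump near the beginning of each of \<open>n\<close> equal blocks, an event whose
  probability follows from the independence of the increments.

  All errors are uniformly negligible against \<open>R\<close> as \<open>\<kappa> / kappa2 D s\<close> tends to infinity. The function
  \<open>kappa2\<close> is the boundary of this regime: above it the optimal number of jumps tends to infinity, and
  \<open>R\<close> dominates the errors of order \<open>ln (1 / s)\<close> (\<open>strike_ratio_bounds\<close>). Hence the call price lies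
  between the Black-Scholes prices at the asymptote multiplied by \<open>1 - \<epsilon>\<close> and by \<open>1 + \<epsilon>\<close>, and strict
  monotonicity of the Black-Scholes price transfers this to the implied volatility.
\<close>

section \<open>Gaussian tails and Black-Scholes prices\<close>

definition normal_tail :: "real \<Rightarrow> real" where
  "normal_tail y = (\<integral>z. indicator {y<..} z * std_normal_density z \<partial>lborel)"

definition bs_price :: "real \<Rightarrow> real \<Rightarrow> real" where
  "bs_price \<kappa> v = (\<integral>z. std_normal_density z * max 0 (exp (v * z - v\<^sup>2 / 2) - exp \<kappa>) \<partial>lborel)"

lemma integrable_tail: "integrable lborel (\<lambda>z. indicator {y<..} z * std_normal_density z)"
  using integrable_mult_indicator[of "{y<..}" lborel std_normal_density] by simp

text \<open>
  Differentiability of the tail is a local matter, so the tail is compared with the integral of the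
  density over a bounded interval around \<open>y\<close>, where the fundamental theorem of calculus applies.
\<close>

lemma has_real_derivative_normal_tail:
  "(normal_tail has_real_derivative - std_normal_density y) (at y)"
proof -
  have cont: "continuous_on A std_normal_density" for A
    unfolding std_normal_density_def by (intro continuous_intros) auto
  have eq: "normal_tail z = normal_tail (y - 1) - integral {y - 1..z} std_normal_density"
    if "z \<in> {y - 1<..<y + 1}" for z
  proof -
    have si: "set_integrable lborel {y - 1..z} std_normal_density"
      unfolding set_integrable_def by (intro integrable_mult_indicator) auto
    have 1: "integral {y - 1..z} std_normal_density = (\<integral>u. indicator {y - 1..z} u * std_normal_density u \<partial>lborel)"
      using set_borel_integral_eq_integral(2)[OF si] by (simp add: set_lebesgue_integral_def)
    have 2: "normal_tail (y - 1) = (\<integral>u. indicator {y - 1..z} u * std_normal_density u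
        + indicator {z<..} u * std_normal_density u \<partial>lborel)"
      unfolding normal_tail_def
    proof (rule integral_cong_AE)
      have "AE u in lborel. u \<noteq> y - 1" by (rule AE_lborel_singleton)
      then show "AE u in lborel. indicator {y - 1<..} u * std_normal_density u =
          indicator {y - 1..z} u * std_normal_density u + indicator {z<..} u * std_normal_density u"
      proof eventually_elim
        case (elim u)
        then show ?case using that by (auto simp: indicator_def)
      qed
    qed auto
    show ?thesis
      unfolding 1 2 using si integrable_tail[of z]
      by (subst Bochner_Integration.integral_add) (auto simp: normal_tail_def set_integrable_def)
  qed
  have "((\<lambda>z. integral {y - 1..z} std_normal_density) has_real_derivative std_normal_density y) 
      (at y within {y - 1..y + 1})"
    by (rule integral_has_real_derivative) (auto intro: cont)
  then have "((\<lambda>z. integral {y - 1..z} std_normal_density) has_real_derivative std_normal_density y) (at y)"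
    by (simp add: at_within_Icc_at)
  then have "((\<lambda>z. normal_tail (y - 1) - integral {y - 1..z} std_normal_density) 
      has_real_derivative 0 - std_normal_density y) (at y)"
    by (intro DERIV_diff DERIV_const)
  then show ?thesis
    by (subst has_field_derivative_cong_ev[OF refl _ refl refl, where g = "\<lambda>z. normal_tail (y - 1) - integral {y - 1..z} std_normal_density"])
      (auto intro!: eventually_mono[OF eventually_nhds_in_open[of "{y - 1<..<y + 1}"]] eq)
qed

lemma normal_tail_shift:
  "normal_tail y = (\<integral>z. indicator {y + v<..} z * std_normal_density (z - v) \<partial>lborel)"
proof -
  have "indicator {y<..} (- v + z) = (indicator {y + v<..} z :: real)" for z
    by (auto simp: indicator_def)
  then show ?thesis
    unfolding normal_tail_def
    using lborel_integral_real_affine[of 1 "\<lambda>z. indicator {y<..} z * std_normal_density z" "- v"]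
    by simp
qed

lemma integrable_tail_shift:
  "integrable lborel (\<lambda>z. indicator {y<..} z * std_normal_density (z - v))"
proof -
  have "indicator {y - v<..} (- v + z) = (indicator {y<..} z :: real)" for z
    by (auto simp: indicator_def)
  then show ?thesis
    using lborel_integrable_real_affine[OF integrable_tail[of "y - v"], of 1 "-v"] by simp
qed

text \<open>
  The Esscher transform: weighting with \<open>exp (v z - v\<^sup>2 / 2)\<close> shifts the normal law by \<open>v\<close>. It turns the
  stock part of the payoff into an ordinary Gaussian tail.
\<close>

lemma std_normal_density_tilt:
  "std_normal_density z * exp (v * z - v\<^sup>2 / 2) = std_normal_density (z - v)"
proof -
  have "- (z - v)\<^sup>2 / 2 = - z\<^sup>2 / 2 + (v * z - v\<^sup>2 / 2)"
    by (simp add: power2_diff field_simps)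
  then have "exp (- (z - v)\<^sup>2 / 2) = exp (- z\<^sup>2 / 2) * exp (v * z - v\<^sup>2 / 2)"
    by (simp only: exp_add)
  then show ?thesis by (simp only: std_normal_density_def mult.assoc)
qed

text \<open>
  On the half-line beyond \<open>y \<ge> 0\<close> the density is dominated by \<open>exp (- y\<^sup>2 / 2)\<close> times the density
  recentred at \<open>y\<close>, because \<open>z\<^sup>2 = y\<^sup>2 + (z - y)\<^sup>2 + 2 y (z - y)\<close>.
\<close>

lemma normal_tail_le_exp:
  assumes "0 \<le> y"
  shows "normal_tail y \<le> exp (- y\<^sup>2 / 2)"
proof -
  have "normal_tail y \<le> (\<integral>z. exp (- y\<^sup>2 / 2) * std_normal_density (z - y) \<partial>lborel)"
    unfolding normal_tail_def
  proof (rule integral_mono_AE[OF integrable_tail])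
    show "integrable lborel (\<lambda>z. exp (- y\<^sup>2 / 2) * std_normal_density (z - y))"
      using lborel_integrable_real_affine[OF integrable_normal_density[of 1 0], of 1 "-y"] by simp
    have "std_normal_density z \<le> exp (- y\<^sup>2 / 2) * std_normal_density (z - y)" if "y < z" for z
    proof -
      have "0 \<le> y * (z - y)" using that assms by simp
      moreover have "- z\<^sup>2 / 2 = - y\<^sup>2 / 2 + - (z - y)\<^sup>2 / 2 - y * (z - y)"
        by (simp add: power2_eq_square field_simps)
      ultimately have "exp (- z\<^sup>2 / 2) \<le> exp (- y\<^sup>2 / 2) * exp (- (z - y)\<^sup>2 / 2)"
        unfolding exp_add[symmetric] by simp
      then show ?thesis
        by (simp add: std_normal_density_def divide_right_mono)
    qed
    then show "AE z in lborel. indicator {y<..} z * std_normal_density z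
        \<le> exp (- y\<^sup>2 / 2) * std_normal_density (z - y)"
      by (auto simp: indicator_def)
  qed
  also have "\<dots> = exp (- y\<^sup>2 / 2) * (\<integral>z. std_normal_density (z - y) \<partial>lborel)" by simp
  also have "(\<integral>z. std_normal_density (z - y) \<partial>lborel) = 1"
    using lborel_integral_real_affine[of 1 std_normal_density "-y"] by simp
  finally show ?thesis by simp
qed

lemma normal_tail_bounds: "0 \<le> normal_tail y" "normal_tail y \<le> 1"
proof -
  show "0 \<le> normal_tail y" unfolding normal_tail_def by (intro Bochner_Integration.integral_nonneg) auto
  have "normal_tail y \<le> (\<integral>z. std_normal_density z \<partial>lborel)"
    unfolding normal_tail_def
    by (intro integral_mono integrable_tail) (auto simp: indicator_def)
  then show "normal_tail y \<le> 1" by simp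
qed

lemma bs_payoff_split:
  assumes "0 < v"
  shows "std_normal_density z * max 0 (exp (v * z - v\<^sup>2 / 2) - exp \<kappa>) =
    indicator {\<kappa> / v + v / 2<..} z * std_normal_density (z - v)
    - exp \<kappa> * (indicator {\<kappa> / v + v / 2<..} z * std_normal_density z)"
proof -
  have "exp \<kappa> < exp (v * z - v\<^sup>2 / 2) \<longleftrightarrow> \<kappa> / v + v / 2 < z"
    using assms by (simp add: field_simps power2_eq_square)
  then show ?thesis
    unfolding std_normal_density_tilt[of z v, symmetric]
    by (auto simp: indicator_def max_def algebra_simps)
qed

lemma integrable_bs_payoff:
  assumes "0 < v"
  shows "integrable lborel (\<lambda>z. std_normal_density z * max 0 (exp (v * z - v\<^sup>2 / 2) - exp \<kappa>))"
  unfolding bs_payoff_split[OF assms] using integrable_tail_shift integrable_tail by auto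

lemma bs_price_formula:
  assumes "0 < v"
  shows "bs_price \<kappa> v = normal_tail (\<kappa> / v - v / 2) - exp \<kappa> * normal_tail (\<kappa> / v + v / 2)"
proof -
  have "bs_price \<kappa> v = (\<integral>z. indicator {\<kappa> / v + v / 2<..} z * std_normal_density (z - v) \<partial>lborel)
      - exp \<kappa> * normal_tail (\<kappa> / v + v / 2)"
    unfolding bs_price_def bs_payoff_split[OF assms] normal_tail_def
    by (subst Bochner_Integration.integral_diff) (use integrable_tail_shift integrable_tail in auto)
  then show ?thesis using normal_tail_shift[of "\<kappa> / v - v / 2" v] by (simp add: field_simps)
qed

text \<open>
  The vega. The derivatives of the two arguments \<open>\<kappa> / v \<mp> v / 2\<close> differ by \<open>1\<close>, and the densities at
  these arguments, weighted as in the Black-Scholes formula, are equal; the remaining terms cancel.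
  Positivity of the vega makes the implied volatility unique.
\<close>

lemma has_real_derivative_bs_price:
  assumes "0 < v"
  shows "(bs_price \<kappa> has_real_derivative std_normal_density (\<kappa> / v - v / 2)) (at v)"
proof -
  have *: "exp \<kappa> * std_normal_density (\<kappa> / v + v / 2) = std_normal_density (\<kappa> / v - v / 2)"
  proof -
    have "- (\<kappa> / v - v / 2)\<^sup>2 / 2 = \<kappa> + - (\<kappa> / v + v / 2)\<^sup>2 / 2"
      using assms by (simp add: power2_eq_square field_simps)
    then have "exp (- (\<kappa> / v - v / 2)\<^sup>2 / 2) = exp \<kappa> * exp (- (\<kappa> / v + v / 2)\<^sup>2 / 2)"
      by (simp only: exp_add)
    then show ?thesis by (simp only: std_normal_density_def mult.left_commute)
  qed
  have "((\<lambda>v. normal_tail (\<kappa> / v - v / 2) - exp \<kappa> * normal_tail (\<kappa> / v + v / 2)) has_real_derivative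
      - std_normal_density (\<kappa> / v - v / 2) * (- \<kappa> / v\<^sup>2 - 1 / 2)
      - exp \<kappa> * (- std_normal_density (\<kappa> / v + v / 2) * (- \<kappa> / v\<^sup>2 + 1 / 2))) (at v)"
    using assms
    by (intro DERIV_diff DERIV_cmult DERIV_chain2[OF has_real_derivative_normal_tail])
      (auto intro!: derivative_eq_intros simp: power2_eq_square)
  also have "- std_normal_density (\<kappa> / v - v / 2) * (- \<kappa> / v\<^sup>2 - 1 / 2)
      - exp \<kappa> * (- std_normal_density (\<kappa> / v + v / 2) * (- \<kappa> / v\<^sup>2 + 1 / 2))
      = std_normal_density (\<kappa> / v - v / 2)"
  proof -
    have "- p * (k - 1 / 2) - e * (- q * (k + 1 / 2)) = p" if "e * q = p" for e p q k :: real
      unfolding that[symmetric] by (simp add: field_simps)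
    then show ?thesis using * .
  qed
  finally show ?thesis
    by (rule has_field_derivative_transform_within_open[where S = "{0<..}"])
      (use assms bs_price_formula in auto)
qed

lemma bs_price_strict_mono:
  assumes "0 < v" "v < w"
  shows "bs_price \<kappa> v < bs_price \<kappa> w"
proof (rule DERIV_pos_imp_increasing[OF assms(2)])
  fix u assume "v \<le> u" "u \<le> w"
  then have "0 < u" using assms by simp
  then show "\<exists>y. (bs_price \<kappa> has_real_derivative y) (at u) \<and> 0 < y"
    using has_real_derivative_bs_price normal_density_pos[of 1] by (metis zero_less_one)
qed

lemma continuous_on_bs_price:
  assumes "A \<subseteq> {0<..}"
  shows "continuous_on A (bs_price \<kappa>)"
proof (rule continuous_at_imp_continuous_on, rule ballI)
  fix u assume "u \<in> A"
  then have "0 < u" using assms by auto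
  then show "isCont (bs_price \<kappa>) u" by (rule DERIV_isCont[OF has_real_derivative_bs_price])
qed

lemma bs_price_nonneg: "0 \<le> bs_price \<kappa> v"
  unfolding bs_price_def by (intro Bochner_Integration.integral_nonneg) auto

lemma bs_price_0: "0 \<le> \<kappa> \<Longrightarrow> bs_price \<kappa> 0 = 0"
  by (simp add: bs_price_def)

lemma bs_price_mono:
  assumes "0 \<le> \<kappa>" "0 \<le> v" "v \<le> w"
  shows "bs_price \<kappa> v \<le> bs_price \<kappa> w"
  using assms bs_price_strict_mono[of v w \<kappa>] bs_price_nonneg[of \<kappa> w] bs_price_0[of \<kappa>]
  by (cases "v = 0 \<or> v = w") auto

text \<open>
  Without the exercise cost the price is the tail at \<open>\<kappa> / v - v / 2\<close>, and
  \<open>(\<kappa> / v - v / 2)\<^sup>2 / 2 = \<kappa>\<^sup>2 / (2 v\<^sup>2) - \<kappa> / 2 + v\<^sup>2 / 8\<close>. Where this argument is negative the tail bound is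
  not available, but the right-hand side is then at least \<open>1\<close>. Having one bound for all \<open>v\<close> is what
  allows it to be integrated against the law of the random clock.
\<close>

lemma bs_price_le_exp:
  assumes "0 \<le> \<kappa>" "0 < v"
  shows "bs_price \<kappa> v \<le> exp (\<kappa> / 2 - \<kappa>\<^sup>2 / (2 * v\<^sup>2))"
proof -
  have "bs_price \<kappa> v \<le> normal_tail (\<kappa> / v - v / 2)"
    using normal_tail_bounds by (simp add: bs_price_formula[OF assms(2)])
  also have "\<dots> \<le> exp (\<kappa> / 2 - \<kappa>\<^sup>2 / (2 * v\<^sup>2))"
  proof (cases "v / 2 \<le> \<kappa> / v")
    case True
    then have "normal_tail (\<kappa> / v - v / 2) \<le> exp (- (\<kappa> / v - v / 2)\<^sup>2 / 2)"
      by (intro normal_tail_le_exp) auto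
    also have "- (\<kappa> / v - v / 2)\<^sup>2 / 2 = \<kappa> / 2 - \<kappa>\<^sup>2 / (2 * v\<^sup>2) - v\<^sup>2 / 8"
      using assms by (simp add: power2_eq_square field_simps)
    finally show ?thesis by (smt (verit) exp_le_cancel_iff zero_le_power2 divide_nonneg_pos)
  next
    case False
    then have "\<kappa> / v\<^sup>2 \<le> 1 / 2" using assms by (simp add: power2_eq_square field_simps)
    then have "\<kappa> * (\<kappa> / v\<^sup>2) \<le> \<kappa> * (1 / 2)" using assms by (intro mult_left_mono)
    moreover have "\<kappa>\<^sup>2 / (2 * v\<^sup>2) = \<kappa> * (\<kappa> / v\<^sup>2) / 2" by (simp add: power2_eq_square)
    ultimately have "\<kappa>\<^sup>2 / (2 * v\<^sup>2) \<le> \<kappa> * (1 / 2) / 2"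
      by (metis divide_right_mono zero_le_numeral)
    then have "0 \<le> \<kappa> / 2 - \<kappa>\<^sup>2 / (2 * v\<^sup>2)" using assms(1) by simp
    then show ?thesis using normal_tail_bounds(2) by (smt (verit) one_le_exp_iff)
  qed
  finally show ?thesis .
qed

lemma bs_price_le_1:
  assumes "0 \<le> \<kappa>" "0 \<le> v"
  shows "bs_price \<kappa> v \<le> 1"
proof (cases "v = 0")
  case False
  then show ?thesis
    using assms normal_tail_bounds[of "\<kappa> / v - v / 2"] normal_tail_bounds[of "\<kappa> / v + v / 2"]
    by (auto simp: bs_price_formula) (smt (verit) mult_nonneg_nonneg exp_gt_zero)
qed (use assms bs_price_0 in auto)

text \<open>
  One unit interval of outcomes \<open>z\<close>, starting one unit beyond the exercise threshold
  \<open>\<kappa> / v + v / 2\<close>, already carries enough mass: there the payoff is at least \<open>exp (\<kappa> + v) - exp \<kappa> \<ge> v\<close>.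
  Only the exponent matters later, so the shift by \<open>2\<close> and the factor \<open>v\<close> are harmless.
\<close>

lemma bs_price_ge:
  assumes "0 \<le> \<kappa>" "0 < v"
  shows "v * std_normal_density (\<kappa> / v + v / 2 + 2) \<le> bs_price \<kappa> v"
proof -
  define d where "d = \<kappa> / v + v / 2"
  have d: "0 \<le> d" using assms by (simp add: d_def)
  have "v * std_normal_density (d + 2) = (\<integral>z. indicator {d + 1..d + 2} z * (v * std_normal_density (d + 2)) \<partial>lborel)"
    by simp
  also have "\<dots> \<le> bs_price \<kappa> v"
    unfolding bs_price_def
  proof (rule integral_mono)
    show "integrable lborel (\<lambda>z. indicator {d + 1..d + 2} z * (v * std_normal_density (d + 2)))"
      by (intro integrable_mult_left integrable_real_indicator) auto
    show "integrable lborel (\<lambda>z. std_normal_density z * max 0 (exp (v * z - v\<^sup>2 / 2) - exp \<kappa>))"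
      using assms by (intro integrable_bs_payoff) auto
    fix z :: real
    show "indicator {d + 1..d + 2} z * (v * std_normal_density (d + 2))
        \<le> std_normal_density z * max 0 (exp (v * z - v\<^sup>2 / 2) - exp \<kappa>)"
    proof (cases "z \<in> {d + 1..d + 2}")
      case True
      then have "z\<^sup>2 \<le> (d + 2)\<^sup>2" using d by (intro power_mono) auto
      then have phi: "std_normal_density (d + 2) \<le> std_normal_density z"
        by (auto simp: std_normal_density_def field_simps)
      have "v * (d + 1) \<le> v * z" using True assms by (intro mult_left_mono) auto
      moreover have "v * (d + 1) = \<kappa> + v\<^sup>2 / 2 + v"
        using assms by (simp add: d_def power2_eq_square field_simps)
      ultimately have "\<kappa> + v \<le> v * z - v\<^sup>2 / 2" by linarith
      then have "exp (\<kappa> + v) \<le> exp (v * z - v\<^sup>2 / 2)" by simp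
      moreover have "exp \<kappa> * (1 + v) \<le> exp \<kappa> * exp v" by (intro mult_left_mono exp_ge_add_one_self) auto
      moreover have "1 * v \<le> exp \<kappa> * v" using assms by (intro mult_right_mono) auto
      ultimately have "v \<le> exp (v * z - v\<^sup>2 / 2) - exp \<kappa>" by (simp add: exp_add algebra_simps)
      then have "std_normal_density (d + 2) * v \<le> std_normal_density z * max 0 (exp (v * z - v\<^sup>2 / 2) - exp \<kappa>)"
        using phi assms by (intro mult_mono) auto
      then show ?thesis using True by (simp add: mult.commute)
    qed auto
  qed
  finally show ?thesis by (simp add: d_def)
qed

section \<open>Conditioning on the random clock\<close>

lemma distributed_brownian_motion:
  assumes "brownian_motion P W" "0 < v"
  shows "distributed P lborel (W (v\<^sup>2)) (normal_density 0 v)"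
proof -
  have "distributed P lborel (\<lambda>\<omega>. W (v\<^sup>2) \<omega> - W 0 \<omega>) (normal_density 0 (sqrt (v\<^sup>2 - 0)))"
    using assms unfolding brownian_motion_def by (metis order_refl zero_less_power)
  moreover have "distr P lborel (\<lambda>\<omega>. W (v\<^sup>2) \<omega> - W 0 \<omega>) = distr P lborel (W (v\<^sup>2))"
    using assms by (intro distr_cong) (auto simp: brownian_motion_def)
  moreover have "W (v\<^sup>2) \<in> borel_measurable P"
    using assms by (auto simp: brownian_motion_def)
  ultimately show ?thesis using assms(2) by (simp add: distributed_def)
qed

lemma nn_integral_call_payoff_brownian_motion:
  assumes "prob_space P" "brownian_motion P W" "0 \<le> \<kappa>" "0 \<le> v"
  shows "(\<integral>\<^sup>+\<omega>. ennreal (max 0 (exp (W (v\<^sup>2) \<omega> - v\<^sup>2 / 2) - exp \<kappa>)) \<partial>P) = ennreal (bs_price \<kappa> v)"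
proof (cases "v = 0")
  case True
  interpret prob_space P by fact
  have "(\<integral>\<^sup>+\<omega>. ennreal (max 0 (exp (W (v\<^sup>2) \<omega> - v\<^sup>2 / 2) - exp \<kappa>)) \<partial>P) = (\<integral>\<^sup>+\<omega>. 0 \<partial>P)"
    using assms True by (intro nn_integral_cong) (auto simp: brownian_motion_def)
  then show ?thesis using True assms by (simp add: bs_price_0)
next
  case False
  then have v: "0 < v" using assms by simp
  define g where "g y = max 0 (exp (y - v\<^sup>2 / 2) - exp \<kappa>)" for y
  have g_nonneg: "0 \<le> g y" for y by (simp add: g_def)
  have [measurable]: "g \<in> borel_measurable borel" unfolding g_def by measurable
  have "(\<integral>\<^sup>+\<omega>. ennreal (g (W (v\<^sup>2) \<omega>)) \<partial>P) = (\<integral>\<^sup>+y. ennreal (normal_density 0 v y) * ennreal (g y) \<partial>lborel)"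
    by (rule distributed_nn_integral[OF distributed_brownian_motion[OF assms(2) v], symmetric]) auto
  also have "\<dots> = ennreal \<bar>v\<bar> * (\<integral>\<^sup>+z. ennreal (normal_density 0 v (0 + v * z)) * ennreal (g (0 + v * z)) \<partial>lborel)"
    using v by (intro nn_integral_real_affine) auto
  also have "\<dots> = (\<integral>\<^sup>+z. ennreal \<bar>v\<bar> * (ennreal (normal_density 0 v (0 + v * z)) * ennreal (g (0 + v * z))) \<partial>lborel)"
    by (rule nn_integral_cmult[symmetric]) measurable
  also have "\<dots> = (\<integral>\<^sup>+z. ennreal (std_normal_density z * g (v * z)) \<partial>lborel)"
  proof (intro nn_integral_cong)
    fix z :: real
    have "v * normal_density 0 v (v * z) = std_normal_density z"
      using v by (simp add: normal_density_def real_sqrt_mult power_mult_distrib)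
    then show "ennreal \<bar>v\<bar> * (ennreal (normal_density 0 v (0 + v * z)) * ennreal (g (0 + v * z))) =
        ennreal (std_normal_density z * g (v * z))"
      using v g_nonneg by (simp add: ennreal_mult[symmetric] mult.assoc[symmetric])
  qed
  also have "\<dots> = ennreal (bs_price \<kappa> v)"
    unfolding bs_price_def g_def
    by (rule nn_integral_eq_integral[OF integrable_bs_payoff[OF v]]) auto
  finally show ?thesis by (simp add: g_def)
qed

lemma C_BS_eq_bs_price:
  assumes "prob_space P" "brownian_motion P W" "0 \<le> \<kappa>" "0 \<le> v"
  shows "C_BS P W \<kappa> v = bs_price \<kappa> v"
proof -
  have [measurable]: "W (v\<^sup>2) \<in> borel_measurable P"
    using assms by (auto simp: brownian_motion_def)
  have "C_BS P W \<kappa> v = enn2real (\<integral>\<^sup>+\<omega>. ennreal (max 0 (exp (W (v\<^sup>2) \<omega> - v\<^sup>2 / 2) - exp \<kappa>)) \<partial>P)"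
    unfolding C_BS_def by (rule integral_eq_nn_integral) auto
  then show ?thesis
    by (simp only: nn_integral_call_payoff_brownian_motion[OF assms] enn2real_ennreal bs_price_nonneg)
qed

text \<open>
  Evaluating a path at a random time is not measurable for the product \<open>\<sigma>\<close>-algebra on all paths.
  Reading the path at the dyadic times just above \<open>v\<close> and passing to the limit is measurable, since
  only countably many times enter, and agrees with evaluation on continuous paths.
\<close>

definition dyadic_eval :: "(real \<Rightarrow> real) \<Rightarrow> real \<Rightarrow> real" where
  "dyadic_eval w v = lim (\<lambda>k. w (real (nat \<lceil>2 ^ k * v\<rceil>) / 2 ^ k))"

text \<open>
  The time at which the path is read takes countably many values, so each approximation is a
  countable case distinction between coordinate projections.
\<close>

lemma measurable_dyadic_eval:
  "(\<lambda>p. dyadic_eval (fst p) (snd p)) \<in> borel_measurable (PiM {0..} (\<lambda>_. borel) \<Otimes>\<^sub>M borel)"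
  unfolding dyadic_eval_def
proof (rule borel_measurable_lim_metric)
  fix k :: nat
  show "(\<lambda>p. fst p (real (nat \<lceil>2 ^ k * snd p\<rceil>) / 2 ^ k))
      \<in> borel_measurable (PiM {0..} (\<lambda>_. borel) \<Otimes>\<^sub>M (borel :: real measure))"
  proof (rule measurable_compose_countable[where g = "\<lambda>p. nat \<lceil>2 ^ k * snd p\<rceil>"
        and f = "\<lambda>i p. fst p (real i / 2 ^ k)"])
    fix i :: nat
    show "(\<lambda>p. fst p (real i / 2 ^ k)) \<in> borel_measurable (PiM {0..} (\<lambda>_. borel) \<Otimes>\<^sub>M (borel :: real measure))"
      by (rule measurable_compose[OF measurable_fst measurable_component_singleton]) auto
  qed measurable
qed

lemma dyadic_eval_continuous:
  assumes "continuous_on {0..} w" "0 \<le> v"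
  shows "dyadic_eval (restrict w {0..}) v = w v"
proof -
  define d where "d k = real (nat \<lceil>2 ^ k * v\<rceil>) / 2 ^ k" for k :: nat
  have d0: "d k \<in> {0..}" for k by (simp add: d_def)
  have ceil: "real (nat \<lceil>2 ^ k * v\<rceil>) = of_int \<lceil>2 ^ k * v\<rceil>" for k :: nat
    using assms by (simp add: order.strict_trans2[of "-1" 0])
  have lower: "v \<le> d k" for k
    unfolding d_def ceil by (simp add: field_simps)
  have upper: "d k \<le> v + (1 / 2) ^ k" for k
    unfolding d_def ceil using ceiling_correct[of "2 ^ k * v"] by (simp add: field_simps power_divide)
  have "(\<lambda>k. v + (1 / 2) ^ k) \<longlonglongrightarrow> v + 0"
    by (intro tendsto_intros) (auto intro!: LIMSEQ_power_zero)
  then have "d \<longlonglongrightarrow> v"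
    using lower upper by (intro tendsto_sandwich[of "\<lambda>_. v" d sequentially "\<lambda>k. v + (1 / 2) ^ k"]) auto
  then have "(\<lambda>k. w (d k)) \<longlonglongrightarrow> w v"
    using assms d0 by (intro continuous_on_tendsto_compose[OF assms(1)]) auto
  then have "(\<lambda>k. restrict w {0..} (d k)) \<longlonglongrightarrow> w v" using d0 by simp
  then show ?thesis unfolding dyadic_eval_def d_def by (rule limI)
qed

text \<open>
  Conditioning on the clock. By independence the joint law of the two paths is a product, so Fubini's
  theorem applies; with the clock frozen at the value \<open>I t \<omega>'\<close> the log-price is that of a Black-Scholes
  model with total variance \<open>I t \<omega>'\<close>. The passage through \<open>dyadic_eval\<close> makes the payoff a measurable
  function of the pair of paths.
\<close>

lemma call_price_time_changed:
  assumes "prob_space P" "brownian_motion P W" "independent_processes P W I"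
    and "0 \<le> t" "0 \<le> \<kappa>" "\<And>\<omega>. \<omega> \<in> space P \<Longrightarrow> 0 \<le> I t \<omega>"
  shows "I t \<in> borel_measurable P"
    and "call_price P (log_price W I) \<kappa> t = (\<integral>\<omega>. bs_price \<kappa> (sqrt (I t \<omega>)) \<partial>P)"
proof -
  interpret prob_space P by fact
  define S where "S = (\<Pi>\<^sub>M i\<in>{0::real..}. (borel :: real measure))"
  define w where "w \<omega> = restrict (\<lambda>s. W s \<omega>) {0..}" for \<omega>
  define y where "y \<omega> = restrict (\<lambda>s. I s \<omega>) {0..}" for \<omega>
  have ind: "indep_var S w S y"
    using assms(3) by (simp add: independent_processes_def S_def w_def[abs_def] y_def[abs_def])
  then have w[measurable]: "w \<in> measurable P S" and y[measurable]: "y \<in> measurable P S"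
    by (auto dest: indep_var_rv1 indep_var_rv2)
  have comp[measurable]: "(\<lambda>i. i t) \<in> measurable S borel"
    unfolding S_def using assms(4) by (intro measurable_component_singleton) auto
  have "(\<lambda>\<omega>. y \<omega> t) \<in> borel_measurable P" by measurable
  then show It[measurable]: "I t \<in> borel_measurable P" using assms(4) by (simp add: y_def)
  define G where "G p = max 0 (exp (dyadic_eval (fst p) (snd p t) - snd p t / 2) - exp \<kappa>)" for p
  have ev[measurable]: "(\<lambda>p. dyadic_eval (fst p) (snd p t)) \<in> borel_measurable (S \<Otimes>\<^sub>M S)"
    using measurable_compose[OF _ measurable_dyadic_eval, of "\<lambda>p. (fst p, snd p t)" "S \<Otimes>\<^sub>M S"]
    unfolding S_def[symmetric] by simp
  have G[measurable]: "G \<in> borel_measurable (S \<Otimes>\<^sub>M S)" unfolding G_def by measurable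
  have path: "G (w \<omega>, y \<omega>') = max 0 (exp (W (I t \<omega>') \<omega> - I t \<omega>' / 2) - exp \<kappa>)"
    if "\<omega> \<in> space P" "\<omega>' \<in> space P" for \<omega> \<omega>'
    using that assms unfolding G_def w_def y_def
    by (simp add: dyadic_eval_continuous brownian_motion_def)
  interpret dw: prob_space "distr P S w" by (rule prob_space_distr) fact
  interpret dy: prob_space "distr P S y" by (rule prob_space_distr) fact
  interpret pp: pair_sigma_finite "distr P S w" "distr P S y" ..
  have "(\<integral>\<^sup>+\<omega>. ennreal (G (w \<omega>, y \<omega>)) \<partial>P) = (\<integral>\<^sup>+p. ennreal (G p) \<partial>distr P (S \<Otimes>\<^sub>M S) (\<lambda>\<omega>. (w \<omega>, y \<omega>)))"
    by (rule nn_integral_distr[symmetric]) measurable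
  also have "\<dots> = (\<integral>\<^sup>+p. ennreal (G p) \<partial>(distr P S w \<Otimes>\<^sub>M distr P S y))"
    using ind by (simp add: indep_var_distribution_eq)
  also have "\<dots> = (\<integral>\<^sup>+i. (\<integral>\<^sup>+u. ennreal (G (u, i)) \<partial>distr P S w) \<partial>distr P S y)"
    by (rule pp.nn_integral_snd[symmetric]) simp
  also have "\<dots> = (\<integral>\<^sup>+\<omega>'. (\<integral>\<^sup>+u. ennreal (G (u, y \<omega>')) \<partial>distr P S w) \<partial>P)"
    by (rule nn_integral_distr) measurable
  also have "\<dots> = (\<integral>\<^sup>+\<omega>'. (\<integral>\<^sup>+\<omega>. ennreal (G (w \<omega>, y \<omega>')) \<partial>P) \<partial>P)"
  proof (rule nn_integral_cong)
    fix \<omega>' assume "\<omega>' \<in> space P"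
    then have [measurable]: "y \<omega>' \<in> space S" using y by (rule measurable_space[rotated])
    show "(\<integral>\<^sup>+u. ennreal (G (u, y \<omega>')) \<partial>distr P S w) = (\<integral>\<^sup>+\<omega>. ennreal (G (w \<omega>, y \<omega>')) \<partial>P)"
      by (rule nn_integral_distr) measurable
  qed
  also have "\<dots> = (\<integral>\<^sup>+\<omega>'. ennreal (bs_price \<kappa> (sqrt (I t \<omega>'))) \<partial>P)"
  proof (intro nn_integral_cong)
    fix \<omega>' assume \<omega>': "\<omega>' \<in> space P"
    have "(\<integral>\<^sup>+\<omega>. ennreal (G (w \<omega>, y \<omega>')) \<partial>P) = 
        (\<integral>\<^sup>+\<omega>. ennreal (max 0 (exp (W ((sqrt (I t \<omega>'))\<^sup>2) \<omega> - (sqrt (I t \<omega>'))\<^sup>2 / 2) - exp \<kappa>)) \<partial>P)"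
      using \<omega>' assms(6)[OF \<omega>'] by (intro nn_integral_cong) (simp add: path)
    then show "(\<integral>\<^sup>+\<omega>. ennreal (G (w \<omega>, y \<omega>')) \<partial>P) = ennreal (bs_price \<kappa> (sqrt (I t \<omega>')))"
      using nn_integral_call_payoff_brownian_motion[OF assms(1,2,5), of "sqrt (I t \<omega>')"] assms(6)[OF \<omega>']
      by simp
  qed
  finally have nn: "(\<integral>\<^sup>+\<omega>. ennreal (G (w \<omega>, y \<omega>)) \<partial>P) = (\<integral>\<^sup>+\<omega>'. ennreal (bs_price \<kappa> (sqrt (I t \<omega>'))) \<partial>P)" .
  have "call_price P (log_price W I) \<kappa> t = (\<integral>\<omega>. G (w \<omega>, y \<omega>) \<partial>P)"
    unfolding call_price_def log_price_def by (intro Bochner_Integration.integral_cong) (auto simp: path)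
  also have "\<dots> = enn2real (\<integral>\<^sup>+\<omega>. ennreal (G (w \<omega>, y \<omega>)) \<partial>P)"
    by (rule integral_eq_nn_integral) (measurable, simp add: G_def)
  also have "\<dots> = (\<integral>\<omega>. bs_price \<kappa> (sqrt (I t \<omega>)) \<partial>P)"
  proof -
    have [measurable]: "bs_price \<kappa> \<in> borel_measurable borel"
      unfolding bs_price_def by measurable
    show ?thesis unfolding nn
      by (rule integral_eq_nn_integral[symmetric]) (measurable, simp add: bs_price_nonneg)
  qed
  finally show "call_price P (log_price W I) \<kappa> t = (\<integral>\<omega>. bs_price \<kappa> (sqrt (I t \<omega>)) \<partial>P)" .
qed

section \<open>Bounds for the clock along a path\<close>

lemma powr_le_tangent:
  fixes z p :: real
  assumes "0 \<le> z" "0 < p" "p < 1"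
  shows "z powr p \<le> 1 + p * (z - 1)"
proof (cases "z = 0")
  case False
  then show ?thesis
    using Youngs_inequality_0[of p "1 - p" z 1] assms by (simp add: algebra_simps)
qed (use assms in auto)

text \<open>
  Concavity of \<open>y \<mapsto> y powr p\<close> for \<open>0 < p < 1\<close>, as a tangent inequality at an arbitrary point \<open>h\<close>.
\<close>

lemma powr_le_tangent_at:
  fixes y h p :: real
  assumes "0 \<le> y" "0 < h" "0 < p" "p < 1"
  shows "y powr p \<le> h powr p + p * h powr (p - 1) * (y - h)"
proof -
  have "y powr p = h powr p * (y / h) powr p"
    using assms by (simp add: powr_divide)
  also have "\<dots> \<le> h powr p * (1 + p * (y / h - 1))"
    using assms powr_le_tangent[of "y / h" p] by (intro mult_left_mono) auto
  also have "\<dots> = h powr p + p * h powr (p - 1) * (y - h)"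
    using assms by (simp add: powr_diff field_simps)
  finally show ?thesis .
qed

text \<open>
  For a fixed total the sum of the powers is largest when all terms are equal: add up the tangent
  inequalities at the mean \<open>s / n\<close>, whose linear parts cancel.
\<close>

lemma sum_powr_le:
  fixes y :: "nat \<Rightarrow> real"
  assumes "\<And>k. k < n \<Longrightarrow> 0 \<le> y k" "(\<Sum>k<n. y k) = s" "0 < s" "0 < p" "p < 1"
  shows "(\<Sum>k<n. y k powr p) \<le> real n powr (1 - p) * s powr p"
proof -
  have n: "0 < n" using assms(2,3) by (cases n) auto
  define h where "h = s / real n"
  have h: "0 < h" using n assms by (simp add: h_def)
  have "(\<Sum>k<n. y k powr p) \<le> (\<Sum>k<n. h powr p + p * h powr (p - 1) * (y k - h))"
    using assms h by (intro sum_mono powr_le_tangent_at) auto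
  also have "\<dots> = real n * h powr p + p * h powr (p - 1) * (s - real n * h)"
    by (simp add: sum.distrib sum_subtractf sum_distrib_left[symmetric] assms(2))
  also have "\<dots> = real n * h powr p" using n by (simp add: h_def)
  also have "\<dots> = real n powr (1 - p) * s powr p"
    using n assms by (simp add: h_def powr_divide powr_diff)
  finally show ?thesis .
qed

lemma powr_add_subadditive:
  fixes a b p :: real
  assumes "0 \<le> a" "0 < b" "0 < p" "p < 1"
  shows "(a + b) powr p - b powr p \<le> a powr p"
proof -
  have frac: "x * (a + b) powr (p - 1) \<le> x powr p" if "0 \<le> x" "x \<le> a + b" for x
  proof (cases "x = 0")
    case False
    then have "(a + b) powr (p - 1) \<le> x powr (p - 1)"
      using that assms by (intro powr_mono2') auto
    then have "x * (a + b) powr (p - 1) \<le> x * x powr (p - 1)" using that by (intro mult_left_mono) auto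
    also have "\<dots> = x powr p" using that False by (simp add: powr_diff)
    finally show ?thesis .
  qed simp
  have "(a + b) powr p = a * (a + b) powr (p - 1) + b * (a + b) powr (p - 1)"
    using assms by (simp add: powr_diff add_divide_distrib[symmetric] distrib_right[symmetric])
  also have "\<dots> \<le> a powr p + b powr p" using frac[of a] frac[of b] assms by (intro add_mono) auto
  finally show ?thesis by simp
qed

text \<open>
  The jump times of the path up to \<open>t\<close>, completed by \<open>0\<close> at index \<open>0\<close> and by \<open>t\<close> after the last jump,
  so that consecutive differences partition the interval from \<open>0\<close> to \<open>t\<close>. The parameter
  \<open>tau0\<close> is replaced by \<open>0\<close>.
\<close>

definition jump_partition :: "(real \<Rightarrow> 'a \<Rightarrow> nat) \<Rightarrow> real \<Rightarrow> 'a \<Rightarrow> nat \<Rightarrow> real" where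
  "jump_partition N t \<omega> k =
     (if k = 0 then 0 else if k \<le> N t \<omega> then Inf {s. 0 \<le> s \<and> k \<le> N s \<omega>} else t)"

lemma jump_time_eq_jump_partition:
  "0 < k \<Longrightarrow> k \<le> N t \<omega> \<Longrightarrow> jump_time tau0 N k \<omega> = jump_partition N t \<omega> k"
  by (simp add: jump_time_def jump_partition_def)

lemma jump_partition_le:
  assumes "0 \<le> s" "k \<le> N s \<omega>" "k \<le> N t \<omega>"
  shows "jump_partition N t \<omega> k \<le> s"
  using assms by (auto simp: jump_partition_def intro!: cInf_lower bdd_belowI[of _ 0])

lemma jump_partition_ge:
  assumes "mono_on {0..} (\<lambda>t. N t \<omega>)" "0 \<le> s" "s \<le> t" "N s \<omega> < k"
  shows "s \<le> jump_partition N t \<omega> k"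
proof (cases "k \<le> N t \<omega>")
  case True
  then have "s \<le> Inf {s. 0 \<le> s \<and> k \<le> N s \<omega>}"
  proof (intro cInf_greatest)
    show "{s. 0 \<le> s \<and> k \<le> N s \<omega>} \<noteq> {}" using True assms by (auto intro!: exI[of _ t])
    fix u assume u: "u \<in> {s. 0 \<le> s \<and> k \<le> N s \<omega>}"
    show "s \<le> u"
    proof (rule ccontr)
      assume "\<not> s \<le> u"
      then have "N u \<omega> \<le> N s \<omega>" using u assms by (intro mono_onD[OF assms(1)]) auto
      then show False using u assms by auto
    qed
  qed
  then show ?thesis using True assms by (auto simp: jump_partition_def)
qed (use assms in \<open>auto simp: jump_partition_def\<close>)

lemma jump_partition_mono:
  assumes "mono_on {0..} (\<lambda>t. N t \<omega>)" "0 \<le> t"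
  shows "jump_partition N t \<omega> k \<le> jump_partition N t \<omega> (Suc k)"
proof (cases "k = 0")
  case True
  have "0 \<le> Inf {s. 0 \<le> s \<and> Suc 0 \<le> N s \<omega>}" if "Suc 0 \<le> N t \<omega>"
    using that assms by (intro cInf_greatest) auto
  then show ?thesis using True assms by (auto simp: jump_partition_def)
next
  case False
  show ?thesis
  proof (cases "Suc k \<le> N t \<omega>")
    case True
    then have "Inf {s. 0 \<le> s \<and> k \<le> N s \<omega>} \<le> Inf {s. 0 \<le> s \<and> Suc k \<le> N s \<omega>}"
      using assms by (intro cInf_superset_mono) (auto intro!: bdd_belowI[of _ 0])
    then show ?thesis using True False by (auto simp: jump_partition_def)
  next
    case F: False
    show ?thesis
      using F False jump_partition_le[of t k N \<omega> t] assms by (auto simp: jump_partition_def)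
  qed
qed

text \<open>
  The clock is a sum of powers of the gaps between jumps, except that its first term is
  \<open>(\<tau>\<^sub>1 - tau0) powr (2 D) - (- tau0) powr (2 D)\<close>. This term is nonnegative and, by subadditivity of the
  power, at most \<open>\<tau>\<^sub>1 powr (2 D)\<close>. So the clock lies between the gap sum without the first gap and the
  full gap sum, whatever \<open>tau0\<close> is.
\<close>

lemma time_change_bounds:
  assumes "mono_on {0..} (\<lambda>t. N t \<omega>)" "0 \<le> t" "0 < D" "D < 1/2" "tau0 < 0"
  defines "u \<equiv> jump_partition N t \<omega>"
  defines "n \<equiv> N t \<omega>"
  shows "(c_const D V lam)\<^sup>2 * (\<Sum>k=1..n. (u (Suc k) - u k) powr (2 * D)) \<le> time_change D V lam tau0 N t \<omega>"
    and "time_change D V lam tau0 N t \<omega> \<le> (c_const D V lam)\<^sup>2 * (\<Sum>k<Suc n. (u (Suc k) - u k) powr (2 * D))"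
proof -
  define J where "J = (t - jump_time tau0 N n \<omega>) powr (2 * D) - (- tau0) powr (2 * D) +
        (\<Sum>k=1..n. (jump_time tau0 N k \<omega> - jump_time tau0 N (k - 1) \<omega>) powr (2 * D))"
  have p: "0 < 2 * D" "2 * D < 1" using assms by auto
  have umono: "u k \<le> u (Suc k)" for k
    unfolding u_def using assms by (intro jump_partition_mono) auto
  have first: "0 \<le> (y - tau0) powr (2 * D) - (- tau0) powr (2 * D)"
    "(y - tau0) powr (2 * D) - (- tau0) powr (2 * D) \<le> y powr (2 * D)" if "0 \<le> y" for y
    using powr_add_subadditive[of y "- tau0" "2 * D"] that p assms(5)
    by (auto intro!: powr_mono2)
  have "(\<Sum>k=1..n. (u (Suc k) - u k) powr (2 * D)) \<le> J \<and> J \<le> (\<Sum>k<Suc n. (u (Suc k) - u k) powr (2 * D))"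
  proof (cases n)
    case 0
    then have "u 1 = t" "u 0 = 0" by (auto simp: u_def n_def jump_partition_def)
    then show ?thesis using 0 first[of t] assms(2) by (simp add: J_def jump_time_def)
  next
    case (Suc m)
    have jt: "jump_time tau0 N k \<omega> = u k" if "0 < k" "k \<le> n" for k
      using that unfolding u_def n_def by (rule jump_time_eq_jump_partition)
    have u0: "u 0 = 0" and un: "u (Suc n) = t" by (auto simp: u_def n_def jump_partition_def)
    have "(\<Sum>k=1..n. (jump_time tau0 N k \<omega> - jump_time tau0 N (k - 1) \<omega>) powr (2 * D))
        = (\<Sum>k<n. (jump_time tau0 N (Suc k) \<omega> - jump_time tau0 N k \<omega>) powr (2 * D))"
      by (rule sum.reindex_bij_witness[of _ Suc "\<lambda>k. k - 1"]) auto
    also have "\<dots> = (jump_time tau0 N 1 \<omega> - tau0) powr (2 * D)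
        + (\<Sum>k<m. (jump_time tau0 N (Suc (Suc k)) \<omega> - jump_time tau0 N (Suc k) \<omega>) powr (2 * D))"
      unfolding Suc sum.lessThan_Suc_shift by (simp add: jump_time_def)
    also have "\<dots> = (u 1 - tau0) powr (2 * D) + (\<Sum>k<m. (u (Suc (Suc k)) - u (Suc k)) powr (2 * D))"
      using Suc jt by simp
    finally have J: "J = (u (Suc n) - u n) powr (2 * D) + ((u 1 - tau0) powr (2 * D) - (- tau0) powr (2 * D))
        + (\<Sum>k<m. (u (Suc (Suc k)) - u (Suc k)) powr (2 * D))"
      using Suc jt[of n] un by (simp add: J_def)
    have lo: "(\<Sum>k=1..n. (u (Suc k) - u k) powr (2 * D)) =
        (\<Sum>k<m. (u (Suc (Suc k)) - u (Suc k)) powr (2 * D)) + (u (Suc n) - u n) powr (2 * D)"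
    proof -
      have "(\<Sum>k=1..n. (u (Suc k) - u k) powr (2 * D)) = (\<Sum>k<n. (u (Suc (Suc k)) - u (Suc k)) powr (2 * D))"
        by (rule sum.reindex_bij_witness[of _ Suc "\<lambda>k. k - 1"]) auto
      then show ?thesis by (simp add: Suc)
    qed
    have hi: "(\<Sum>k<Suc n. (u (Suc k) - u k) powr (2 * D)) =
        (u 1 - u 0) powr (2 * D) + (\<Sum>k<m. (u (Suc (Suc k)) - u (Suc k)) powr (2 * D))
        + (u (Suc n) - u n) powr (2 * D)"
      unfolding sum.lessThan_Suc_shift[of _ n] by (simp add: Suc)
    show ?thesis unfolding J lo hi u0 using first[of "u 1"] umono[of 0] u0 by simp
  qed
  moreover have "time_change D V lam tau0 N t \<omega> = (c_const D V lam)\<^sup>2 * J"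
    by (simp add: time_change_def J_def n_def)
  ultimately show
    "(c_const D V lam)\<^sup>2 * (\<Sum>k=1..n. (u (Suc k) - u k) powr (2 * D)) \<le> time_change D V lam tau0 N t \<omega>"
    "time_change D V lam tau0 N t \<omega> \<le> (c_const D V lam)\<^sup>2 * (\<Sum>k<Suc n. (u (Suc k) - u k) powr (2 * D))"
    by (auto intro: mult_left_mono)
qed

lemma time_change_nonneg:
  assumes "mono_on {0..} (\<lambda>t. N t \<omega>)" "0 \<le> t" "0 < D" "D < 1/2" "tau0 < 0"
  shows "0 \<le> time_change D V lam tau0 N t \<omega>"
proof (rule order_trans[OF _ time_change_bounds(1)[where N = N and D = D]])
  show "0 \<le> (c_const D V lam)\<^sup>2 * (\<Sum>k=1..N t \<omega>. (jump_partition N t \<omega> (Suc k) - jump_partition N t \<omega> k) powr (2 * D))"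
    by (intro mult_nonneg_nonneg sum_nonneg) auto
qed (use assms in auto)

text \<open>
  With \<open>n\<close> jumps there are \<open>n + 1\<close> gaps of total length \<open>t\<close>; equal gaps maximise the sum of powers.
\<close>

lemma time_change_le:
  assumes "mono_on {0..} (\<lambda>t. N t \<omega>)" "0 < t" "0 < D" "D < 1/2" "tau0 < 0"
  shows "time_change D V lam tau0 N t \<omega>
    \<le> (c_const D V lam)\<^sup>2 * (real (N t \<omega>) + 1) powr (1 - 2 * D) * t powr (2 * D)"
proof -
  define u where "u = jump_partition N t \<omega>"
  have "(\<Sum>k<Suc (N t \<omega>). (u (Suc k) - u k) powr (2 * D)) \<le> real (Suc (N t \<omega>)) powr (1 - 2 * D) * t powr (2 * D)"
  proof (rule sum_powr_le)
    show "(\<Sum>k<Suc (N t \<omega>). u (Suc k) - u k) = t"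
      unfolding sum_lessThan_telescope by (auto simp: u_def jump_partition_def)
    show "0 \<le> u (Suc k) - u k" for k
      using jump_partition_mono[of N \<omega> t k] assms by (simp add: u_def)
  qed (use assms in auto)
  then have "(c_const D V lam)\<^sup>2 * (\<Sum>k<Suc (N t \<omega>). (u (Suc k) - u k) powr (2 * D))
      \<le> (c_const D V lam)\<^sup>2 * (real (Suc (N t \<omega>)) powr (1 - 2 * D) * t powr (2 * D))"
    by (intro mult_left_mono) auto
  then show ?thesis
    using time_change_bounds(2)[of N \<omega> t D tau0 V lam] assms unfolding u_def
    by (simp add: mult.assoc add.commute)
qed

text \<open>
  Divide the interval from \<open>0\<close> to \<open>t\<close> into \<open>n\<close> equal blocks, and let each block contain exactly one
  jump, placed in its first fraction \<open>\<delta>\<close>. The gap after every jump then has length at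
  least \<open>(1 - \<delta>) t / n\<close>, so for small \<open>\<delta>\<close> the clock almost attains the maximal order
  \<open>n powr (1 - 2 D) * t powr (2 D)\<close>.
\<close>

lemma time_change_ge_on_grid:
  assumes "mono_on {0..} (\<lambda>t. N t \<omega>)" "N 0 \<omega> = 0" "0 < t" "0 < D" "D < 1/2" "tau0 < 0"
    and "0 < n" "0 < \<delta>" "\<delta> < 1"
    and one: "\<And>i. i < n \<Longrightarrow> N ((real i + \<delta>) * t / n) \<omega> - N (real i * t / n) \<omega> = 1"
    and none: "\<And>i. i < n \<Longrightarrow> N (real (Suc i) * t / n) \<omega> - N ((real i + \<delta>) * t / n) \<omega> = 0"
  shows "(c_const D V lam)\<^sup>2 * (real n * ((1 - \<delta>) * t / n) powr (2 * D)) \<le> time_change D V lam tau0 N t \<omega>"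
proof -
  have mono: "N r \<omega> \<le> N s \<omega>" if "0 \<le> r" "r \<le> s" for r s
    using that by (intro mono_onD[OF assms(1)]) auto
  have step: "N ((real i + \<delta>) * t / n) \<omega> = Suc (N (real i * t / n) \<omega>)"
    "N (real (Suc i) * t / n) \<omega> = Suc (N (real i * t / n) \<omega>)" if "i < n" for i
  proof -
    show *: "N ((real i + \<delta>) * t / n) \<omega> = Suc (N (real i * t / n) \<omega>)"
      using one[OF that] by linarith
    have "N ((real i + \<delta>) * t / n) \<omega> \<le> N (real (Suc i) * t / n) \<omega>"
      using assms(3,7-9) by (intro mono) (auto intro!: divide_right_mono mult_right_mono)
    then show "N (real (Suc i) * t / n) \<omega> = Suc (N (real i * t / n) \<omega>)"
      using none[OF that] * by linarith
  qed
  have grid: "N (real i * t / n) \<omega> = i" if "i \<le> n" for i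
    using that by (induction i) (use assms(2) step in auto)
  then have Nt: "N t \<omega> = n" using assms(7) by (metis nonzero_mult_div_cancel_left of_nat_0_eq_iff order_refl less_irrefl)
  define u where "u = jump_partition N t \<omega>"
  have lower: "real (k - 1) * t / n \<le> u k" if "k \<in> {1..Suc n}" for k
    unfolding u_def
  proof (rule jump_partition_ge[where N = N and \<omega> = \<omega>])
    show "N (real (k - 1) * t / n) \<omega> < k" using grid[of "k - 1"] that by auto
    have "real (k - 1) \<le> n" using that by auto
    then show "real (k - 1) * t / n \<le> t" using assms(3,7) by (simp add: field_simps)
  qed (use assms(1,3) in auto)
  have upper: "u k \<le> (real (k - 1) + \<delta>) * t / n" if "k \<in> {1..n}" for k
    unfolding u_def
    by (rule jump_partition_le) (use that step(1)[of "k - 1"] grid[of "k - 1"] assms(3,8) Nt in auto)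
  have "((1 - \<delta>) * t / n) powr (2 * D) \<le> (u (Suc k) - u k) powr (2 * D)" if "k \<in> {1..n}" for k
  proof (rule powr_mono2)
    have "(1 - \<delta>) * t / n = real k * t / n - (real (k - 1) + \<delta>) * t / n"
      using that assms(7) by (simp add: field_simps of_nat_diff)
    also have "\<dots> \<le> u (Suc k) - u k"
      using lower[of "Suc k"] upper[of k] that by simp
    finally show "(1 - \<delta>) * t / n \<le> u (Suc k) - u k" .
  qed (use assms in auto)
  then have "(\<Sum>k=1..n. ((1 - \<delta>) * t / n) powr (2 * D)) \<le> (\<Sum>k=1..n. (u (Suc k) - u k) powr (2 * D))"
    by (intro sum_mono)
  then have "(c_const D V lam)\<^sup>2 * (real n * ((1 - \<delta>) * t / n) powr (2 * D))
      \<le> (c_const D V lam)\<^sup>2 * (\<Sum>k=1..n. (u (Suc k) - u k) powr (2 * D))"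
    by (intro mult_left_mono) auto
  also have "\<dots> \<le> time_change D V lam tau0 N t \<omega>"
    using time_change_bounds(1)[of N \<omega> t D tau0 V lam] assms(1-6) unfolding u_def Nt by simp
  finally show ?thesis .
qed

section \<open>Poisson estimates and bounds for the call price\<close>

lemma poisson_process_pmf:
  assumes "poisson_process P lam N" "0 \<le> s" "s < t"
  shows "measure P ((\<lambda>\<omega>. N t \<omega> - N s \<omega>) -` {k} \<inter> space P) = pmf (poisson_pmf (lam * (t - s))) k"
proof -
  have [measurable]: "N t \<in> measurable P (count_space UNIV)" "N s \<in> measurable P (count_space UNIV)"
    using assms by (auto simp: poisson_process_def)
  have "measure P ((\<lambda>\<omega>. N t \<omega> - N s \<omega>) -` {k} \<inter> space P)
      = measure (distr P (count_space UNIV) (\<lambda>\<omega>. N t \<omega> - N s \<omega>)) {k}"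
    by (rule measure_distr[symmetric]) auto
  then show ?thesis using assms by (simp add: poisson_process_def measure_pmf_single)
qed

lemma prod_alternating:
  fixes a b :: real
  shows "(\<Prod>j<2 * n. if even j then a else b) = (a * b) ^ n"
  by (induction n) auto

text \<open>
  The event prescribes the \<open>2 n\<close> increments over the grid formed by the block ends and the points at
  fraction \<open>\<delta>\<close> of the blocks: one jump on the first part of each block and none on the second. By
  independence the probabilities multiply, and the exponential factors add up to \<open>exp (- lam * t)\<close>.
\<close>

lemma prob_poisson_grid_event:
  assumes "prob_space P" "poisson_process P lam N"
    and "0 < t" "0 < lam" "0 < n" "0 < \<delta>" "\<delta> < 1"
  defines "E \<equiv> {\<omega> \<in> space P. \<forall>i<n. N ((real i + \<delta>) * t / n) \<omega> - N (real i * t / n) \<omega> = 1 \<and>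
      N (real (Suc i) * t / n) \<omega> - N ((real i + \<delta>) * t / n) \<omega> = 0}"
  shows "E \<in> sets P" "measure P E = exp (- lam * t) * (lam * \<delta> * t / n) ^ n"
proof -
  interpret prob_space P by fact
  define s where "s j = (real (j div 2) + (if even j then 0 else \<delta>)) * t / n" for j :: nat
  define X where "X j \<omega> = N (s (Suc j)) \<omega> - N (s j) \<omega>" for j \<omega>
  define b :: "nat \<Rightarrow> nat" where "b j = (if even j then 1 else 0)" for j
  have s_even: "s (2 * i) = real i * t / n" and s_odd: "s (Suc (2 * i)) = (real i + \<delta>) * t / n" for i
    by (simp_all add: s_def)
  have s_nonneg: "0 \<le> s j" for j using assms by (simp add: s_def)
  have diff: "s (Suc j) - s j = (if even j then \<delta> * t / n else (1 - \<delta>) * t / n)" for j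
  proof (cases "even j")
    case True
    then obtain i where j: "j = 2 * i" by auto
    show ?thesis unfolding j s_even s_odd by (simp add: diff_divide_distrib[symmetric] algebra_simps)
  next
    case False
    then obtain i where j: "j = Suc (2 * i)" by (metis oddE Suc_eq_plus1)
    then have "Suc j = 2 * Suc i" by simp
    then have "s (Suc j) = real (Suc i) * t / n" by (simp only: s_even)
    then show ?thesis using False unfolding j s_odd by (simp add: diff_divide_distrib[symmetric] algebra_simps)
  qed
  have lt: "s j < s (Suc j)" for j
    using diff[of j] assms by (smt (verit) divide_pos_pos mult_pos_pos of_nat_0_less_iff)
  have mono: "mono_on A s" for A
    using lift_Suc_mono_le[of s, OF less_imp_le[OF lt]] by (intro mono_onI)
  have ind: "indep_vars (\<lambda>_. count_space UNIV) X {..<2 * n}"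
  proof -
    have "indep_vars (\<lambda>_. count_space UNIV) (\<lambda>j \<omega>. N (s (Suc j)) \<omega> - N (s j) \<omega>) {..<2 * n}"
    proof -
      have "independent_increments P (count_space UNIV) N"
        using assms(2) by (simp add: poisson_process_def)
      then show ?thesis
        unfolding independent_increments_def using mono s_nonneg by simp
    qed
    then show ?thesis by (simp add: X_def[abs_def])
  qed
  have ne: "{..<2 * n} \<noteq> {}" using assms(5) by (metis emptyE lessThan_iff nat_0_less_mult_iff zero_less_numeral)
  have E_eq: "E = (\<Inter>j\<in>{..<2 * n}. X j -` {b j} \<inter> space P)" (is "E = ?F")
  proof
    show "E \<subseteq> ?F"
    proof
      fix \<omega> assume \<omega>: "\<omega> \<in> E"
      have "X j \<omega> = b j" if "j < 2 * n" for j
      proof (cases "even j")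
        case True
        then obtain i where j: "j = 2 * i" by auto
        show ?thesis using \<omega> that unfolding X_def j s_even s_odd by (simp add: b_def E_def)
      next
        case False
        then obtain i where j: "j = Suc (2 * i)" by (metis oddE Suc_eq_plus1)
        then have "Suc j = 2 * Suc i" by simp
        then have "s (Suc j) = real (Suc i) * t / n" by (simp only: s_even)
        then show ?thesis using \<omega> that False unfolding X_def j s_odd by (simp add: b_def E_def)
      qed
      then show "\<omega> \<in> ?F" using \<omega> by (auto simp: E_def)
    qed
    show "?F \<subseteq> E"
    proof
      fix \<omega> assume \<omega>: "\<omega> \<in> ?F"
      have mem: "\<omega> \<in> X j -` {b j} \<inter> space P" if "j < 2 * n" for j
        by (rule INT_D[OF \<omega>]) (use that in simp)
      have sp: "\<omega> \<in> space P" using mem[of 0] assms(5) by simp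
      have X: "X j \<omega> = b j" if "j < 2 * n" for j using mem[OF that] by simp
      have "N ((real i + \<delta>) * t / n) \<omega> - N (real i * t / n) \<omega> = 1 \<and>
         N (real (Suc i) * t / n) \<omega> - N ((real i + \<delta>) * t / n) \<omega> = 0" if "i < n" for i
      proof -
        have "Suc (Suc (2 * i)) = 2 * Suc i" by simp
        then have s: "s (Suc (Suc (2 * i))) = real (Suc i) * t / n" by (simp only: s_even)
        have "X (2 * i) \<omega> = b (2 * i)" "X (Suc (2 * i)) \<omega> = b (Suc (2 * i))"
          using that by (auto intro!: X)
        then show ?thesis unfolding X_def s s_even s_odd by (simp add: b_def)
      qed
      then show "\<omega> \<in> E" using sp by (auto simp: E_def)
    qed
  qed
  have N_meas: "N u \<in> measurable P (count_space UNIV)" if "0 \<le> u" for u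
    using that assms(2) by (auto simp: poisson_process_def)
  have X_meas: "X j \<in> measurable P (count_space UNIV)" for j
    unfolding X_def[abs_def] using N_meas[OF s_nonneg[of j]] N_meas[OF s_nonneg[of "Suc j"]] by measurable
  show "E \<in> sets P"
    unfolding E_eq using ne by (intro sets.finite_INT measurable_sets[OF X_meas]) auto
  have factor: "prob (X j -` {b j} \<inter> space P)
      = (if even j then lam * \<delta> * t / n * exp (- (lam * \<delta> * t / n)) else exp (- (lam * (1 - \<delta>) * t / n)))" for j
  proof -
    have "prob (X j -` {b j} \<inter> space P) = pmf (poisson_pmf (lam * (s (Suc j) - s j))) (b j)"
      unfolding X_def by (rule poisson_process_pmf[OF assms(2) s_nonneg lt])
    moreover have "0 < lam * (s (Suc j) - s j)" using lt[of j] assms by simp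
    ultimately show ?thesis unfolding diff by (simp add: b_def mult.assoc)
  qed
  have "prob E = (\<Prod>j<2 * n. prob (X j -` {b j} \<inter> space P))"
    unfolding E_eq using ne by (intro indep_varsD_finite[OF ind]) auto
  also have "\<dots> = (lam * \<delta> * t / n * exp (- (lam * \<delta> * t / n)) * exp (- (lam * (1 - \<delta>) * t / n))) ^ n"
    unfolding factor by (rule prod_alternating)
  also have "lam * \<delta> * t / n * exp (- (lam * \<delta> * t / n)) * exp (- (lam * (1 - \<delta>) * t / n))
      = lam * \<delta> * t / n * exp (- lam * t / n)"
    by (simp add: mult.assoc exp_add[symmetric] add_divide_distrib[symmetric] diff_divide_distrib[symmetric] algebra_simps)
  also have "(lam * \<delta> * t / n * exp (- lam * t / n)) ^ n = exp (- lam * t) * (lam * \<delta> * t / n) ^ n"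
  proof -
    have "exp (- lam * t / n) ^ n = exp (real n * (- lam * t / n))" by (rule exp_of_nat_mult[symmetric])
    also have "real n * (- lam * t / n) = - lam * t" using assms(5) by simp
    finally show ?thesis by (simp only: power_mult_distrib mult.commute)
  qed
  finally show "prob E = exp (- lam * t) * (lam * \<delta> * t / n) ^ n" .
qed

text \<open>
  Exponential tilting: the weight \<open>exp (\<theta> k)\<close> turns the Poisson law with rate \<open>r\<close> into the one with rate
  \<open>r * exp \<theta>\<close>, up to the normalising constant \<open>exp (r * (exp \<theta> - 1))\<close>.
\<close>

lemma has_bochner_integral_exp_poisson_process:
  assumes "poisson_process P lam N" "0 < lam" "0 < t"
  shows "has_bochner_integral P (\<lambda>\<omega>. exp (\<theta> * real (N t \<omega>))) (exp (lam * t * (exp \<theta> - 1)))"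
proof (rule has_bochner_integral_nn_integral)
  define r where "r = lam * t"
  have r: "0 < r" using assms by (simp add: r_def)
  have Nt[measurable]: "N t \<in> measurable P (count_space UNIV)"
    using assms by (auto simp: poisson_process_def)
  show "(\<lambda>\<omega>. exp (\<theta> * real (N t \<omega>))) \<in> borel_measurable P" by measurable
  have "distr P (count_space UNIV) (N t) = distr P (count_space UNIV) (\<lambda>\<omega>. N t \<omega> - N 0 \<omega>)"
    using assms by (intro distr_cong) (auto simp: poisson_process_def)
  also have "\<dots> = measure_pmf (poisson_pmf r)"
    using assms unfolding poisson_process_def r_def by (metis diff_zero order_refl)
  finally have distr: "distr P (count_space UNIV) (N t) = measure_pmf (poisson_pmf r)" .
  have "(\<integral>\<^sup>+\<omega>. ennreal (exp (\<theta> * real (N t \<omega>))) \<partial>P) = (\<integral>\<^sup>+k. ennreal (exp (\<theta> * real k)) \<partial>measure_pmf (poisson_pmf r))"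
    unfolding distr[symmetric] by (rule nn_integral_distr[symmetric]) auto
  also have "\<dots> = (\<integral>\<^sup>+k. ennreal (pmf (poisson_pmf r) k) * ennreal (exp (\<theta> * real k)) \<partial>count_space UNIV)"
    by (rule nn_integral_measure_pmf)
  also have "\<dots> = (\<integral>\<^sup>+k. ennreal (pmf (poisson_pmf (r * exp \<theta>)) k) * ennreal (exp (r * (exp \<theta> - 1))) \<partial>count_space UNIV)"
  proof (rule nn_integral_cong)
    fix k :: nat
    have "exp (\<theta> * real k) = exp \<theta> ^ k" by (simp add: exp_of_nat2_mult)
    moreover have "exp (- (r * exp \<theta>)) * exp (r * (exp \<theta> - 1)) = exp (- r)"
      by (simp add: exp_add[symmetric] algebra_simps)
    ultimately have "pmf (poisson_pmf r) k * exp (\<theta> * real k) = pmf (poisson_pmf (r * exp \<theta>)) k * exp (r * (exp \<theta> - 1))"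
      using r by (simp add: power_mult_distrib mult.assoc)
    then show "ennreal (pmf (poisson_pmf r) k) * ennreal (exp (\<theta> * real k))
        = ennreal (pmf (poisson_pmf (r * exp \<theta>)) k) * ennreal (exp (r * (exp \<theta> - 1)))"
      by (simp add: ennreal_mult[symmetric])
  qed
  also have "\<dots> = (\<integral>\<^sup>+k. ennreal (exp (r * (exp \<theta> - 1))) \<partial>measure_pmf (poisson_pmf (r * exp \<theta>)))"
    by (rule nn_integral_measure_pmf[symmetric])
  also have "\<dots> = ennreal (exp (r * (exp \<theta> - 1)))" by simp
  finally show "(\<integral>\<^sup>+\<omega>. ennreal (exp (\<theta> * real (N t \<omega>))) \<partial>P) = ennreal (exp (lam * t * (exp \<theta> - 1)))"
    by (simp add: r_def)
qed auto

text \<open>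
  The tangent at \<open>m\<close> of the convex function \<open>y \<mapsto> y powr (- q)\<close>. It linearises the Gaussian exponent in
  the number of jumps, so that the Poisson expectation becomes an exponential moment.
\<close>

lemma powr_minus_ge_tangent:
  fixes y m q :: real
  assumes "0 < y" "0 < m" "0 < q"
  shows "m powr (- q) * (1 + q) - q * m powr (- q - 1) * y \<le> y powr (- q)"
proof -
  have "ln (y / m) \<le> y / m - 1" using assms by (intro ln_le_minus_one) auto
  then have "q * ln (y / m) \<le> q * (y / m - 1)" using assms by (intro mult_left_mono) auto
  then have "1 - q * (y / m - 1) \<le> exp (- q * ln (y / m))"
    using exp_ge_add_one_self[of "- q * ln (y / m)"] by simp
  also have "exp (- q * ln (y / m)) = y powr (- q) * m powr q"
    using assms by (simp add: powr_def exp_add[symmetric] ln_div algebra_simps)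
  finally have "m powr (- q) * (1 - q * (y / m - 1)) \<le> m powr (- q) * (y powr (- q) * m powr q)"
    by (intro mult_left_mono) auto
  also have "\<dots> = y powr (- q)" using assms by (simp add: powr_minus field_simps)
  also have "m powr (- q) * (1 - q * (y / m - 1)) = m powr (- q) * (1 + q) - q * m powr (- q - 1) * y"
    using assms by (simp add: powr_diff field_simps)
  finally show ?thesis .
qed

context
  fixes P :: "'a measure" and N :: "real \<Rightarrow> 'a \<Rightarrow> nat" and W :: "real \<Rightarrow> 'a \<Rightarrow> real"
    and D V lam tau0 :: real
  assumes prob: "prob_space P" and D: "0 < D" "D < 1/2" and V: "0 < V" and lam: "0 < lam" and tau0: "tau0 < 0"
    and N: "poisson_process P lam N" and W: "brownian_motion P W"
    and indep: "independent_processes P W (time_change D V lam tau0 N)"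
begin

lemma N_path: "\<omega> \<in> space P \<Longrightarrow> mono_on {0..} (\<lambda>t. N t \<omega>)" "\<omega> \<in> space P \<Longrightarrow> N 0 \<omega> = 0"
  using N by (auto simp: poisson_process_def)

lemma c_const_pos: "0 < c_const D V lam"
  using D V lam by (auto simp: c_const_def intro!: divide_pos_pos mult_pos_pos Gamma_real_pos)

lemma call_price_eq_integral_bs_price:
  assumes "0 < t" "0 \<le> \<kappa>"
  shows "call_price P (log_price W (time_change D V lam tau0 N)) \<kappa> t
    = (\<integral>\<omega>. bs_price \<kappa> (sqrt (time_change D V lam tau0 N t \<omega>)) \<partial>P)"
    and "integrable P (\<lambda>\<omega>. bs_price \<kappa> (sqrt (time_change D V lam tau0 N t \<omega>)))"
proof -
  interpret prob_space P by fact
  have nonneg: "0 \<le> time_change D V lam tau0 N t \<omega>" if "\<omega> \<in> space P" for \<omega>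
    using that assms D tau0 N_path by (intro time_change_nonneg) auto
  note * = call_price_time_changed[OF prob W indep less_imp_le[OF assms(1)] assms(2) nonneg]
  show "call_price P (log_price W (time_change D V lam tau0 N)) \<kappa> t
    = (\<integral>\<omega>. bs_price \<kappa> (sqrt (time_change D V lam tau0 N t \<omega>)) \<partial>P)" by (rule *(2))
  have [measurable]: "time_change D V lam tau0 N t \<in> borel_measurable P" by (rule *(1))
  have [measurable]: "bs_price \<kappa> \<in> borel_measurable borel"
    unfolding bs_price_def by measurable
  show "integrable P (\<lambda>\<omega>. bs_price \<kappa> (sqrt (time_change D V lam tau0 N t \<omega>)))"
    by (rule integrable_const_bound[where B = 1])
      (use nonneg assms in \<open>auto simp: bs_price_nonneg intro!: bs_price_le_1\<close>)
qed

text \<open>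
  A Chernoff bound. With \<open>k\<close> jumps the conditional price is at most
  \<open>exp (\<kappa> / 2 - A * (k + 1) powr (- q))\<close>. Bounding the exponent by its tangent at \<open>m\<close> leaves an
  exponential moment of the number of jumps with parameter \<open>\<theta>\<close>, which is explicit. The parameter \<open>m\<close> is
  free and will be chosen as the most likely number of jumps on the way to the strike.
\<close>

lemma call_price_le:
  assumes t: "0 < t" and \<kappa>: "0 \<le> \<kappa>" and m: "0 < m"
  defines "A \<equiv> \<kappa>\<^sup>2 / (2 * (c_const D V lam)\<^sup>2 * t powr (2 * D))" and "q \<equiv> 1 - 2 * D"
  defines "\<theta> \<equiv> q * A * m powr (- q - 1)"
  shows "call_price P (log_price W (time_change D V lam tau0 N)) \<kappa> t
    \<le> exp (\<kappa> / 2 - (1 + q) * A * m powr (- q) + \<theta> + lam * t * (exp \<theta> - 1))"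
proof -
  define c where "c = c_const D V lam"
  have c: "0 < c" using c_const_pos by (simp add: c_def)
  have q: "0 < q" using D by (simp add: q_def)
  define K where "K = exp (\<kappa> / 2 - (1 + q) * A * m powr (- q) + \<theta>)"
  have "has_bochner_integral P (\<lambda>\<omega>. K * exp (\<theta> * real (N t \<omega>))) (K * exp (lam * t * (exp \<theta> - 1)))"
    using has_bochner_integral_exp_poisson_process[OF N lam t, of \<theta>] by (rule has_bochner_integral_mult_right)
  then have int: "integrable P (\<lambda>\<omega>. K * exp (\<theta> * real (N t \<omega>)))"
    and val: "(\<integral>\<omega>. K * exp (\<theta> * real (N t \<omega>)) \<partial>P) = K * exp (lam * t * (exp \<theta> - 1))"
    by (auto simp: has_bochner_integral_iff)
  have le: "bs_price \<kappa> (sqrt (time_change D V lam tau0 N t \<omega>)) \<le> K * exp (\<theta> * real (N t \<omega>))"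
    if \<omega>: "\<omega> \<in> space P" for \<omega>
  proof -
    define y where "y = real (N t \<omega>) + 1"
    define v2 where "v2 = c\<^sup>2 * y powr q * t powr (2 * D)"
    have y: "0 < y" by (simp add: y_def)
    have v2: "0 < v2" using c y t by (simp add: v2_def)
    have "0 \<le> time_change D V lam tau0 N t \<omega>" "time_change D V lam tau0 N t \<omega> \<le> v2"
      using time_change_nonneg[of N \<omega> t D tau0 V lam] time_change_le[of N \<omega> t D tau0 V lam]
        N_path[OF \<omega>] t D tau0 by (auto simp: v2_def c_def q_def y_def)
    then have "bs_price \<kappa> (sqrt (time_change D V lam tau0 N t \<omega>)) \<le> bs_price \<kappa> (sqrt v2)"
      using \<kappa> by (intro bs_price_mono) auto
    also have "\<dots> \<le> exp (\<kappa> / 2 - \<kappa>\<^sup>2 / (2 * (sqrt v2)\<^sup>2))"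
      using v2 \<kappa> by (intro bs_price_le_exp) auto
    also have "\<kappa>\<^sup>2 / (2 * (sqrt v2)\<^sup>2) = A * y powr (- q)"
      using v2 by (simp add: A_def v2_def c_def powr_minus field_simps)
    also have "exp (\<kappa> / 2 - A * y powr (- q)) \<le> exp (\<kappa> / 2 - A * (m powr (- q) * (1 + q) - q * m powr (- q - 1) * y))"
    proof -
      have "0 \<le> A" by (simp add: A_def)
      then have "A * (m powr (- q) * (1 + q) - q * m powr (- q - 1) * y) \<le> A * y powr (- q)"
        using powr_minus_ge_tangent[OF y m q] by (intro mult_left_mono) auto
      then show ?thesis by simp
    qed
    also have "\<dots> = K * exp (\<theta> * real (N t \<omega>))"
      unfolding K_def exp_add[symmetric] by (simp add: \<theta>_def y_def algebra_simps)
    finally show ?thesis .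
  qed
  have "call_price P (log_price W (time_change D V lam tau0 N)) \<kappa> t \<le> (\<integral>\<omega>. K * exp (\<theta> * real (N t \<omega>)) \<partial>P)"
    unfolding call_price_eq_integral_bs_price(1)[OF t \<kappa>]
    by (rule integral_mono'[OF int le]) (auto simp: K_def)
  also have "\<dots> = exp (\<kappa> / 2 - (1 + q) * A * m powr (- q) + \<theta> + lam * t * (exp \<theta> - 1))"
    unfolding val by (simp only: K_def exp_add[symmetric])
  finally show ?thesis .
qed

text \<open>
  Restricting to the grid event costs its probability; on it the total variance is at least \<open>v\<^sup>2\<close>, and
  Black-Scholes prices increase with the variance. Both \<open>n\<close> and \<open>\<delta>\<close> are free.
\<close>

lemma call_price_ge:
  assumes t: "0 < t" and \<kappa>: "0 \<le> \<kappa>" and n: "0 < n" and \<delta>: "0 < \<delta>" "\<delta> < 1"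
  defines "v \<equiv> c_const D V lam * sqrt n * ((1 - \<delta>) * t / n) powr D"
  shows "exp (- lam * t) * (lam * \<delta> * t / n) ^ n * (v * std_normal_density (\<kappa> / v + v / 2 + 2))
    \<le> call_price P (log_price W (time_change D V lam tau0 N)) \<kappa> t"
proof -
  interpret prob_space P by fact
  define E where "E = {\<omega> \<in> space P. \<forall>i<n. N ((real i + \<delta>) * t / n) \<omega> - N (real i * t / n) \<omega> = 1 \<and>
      N (real (Suc i) * t / n) \<omega> - N ((real i + \<delta>) * t / n) \<omega> = 0}"
  have E: "E \<in> sets P" "prob E = exp (- lam * t) * (lam * \<delta> * t / n) ^ n"
    unfolding E_def by (rule prob_poisson_grid_event[OF prob N t lam n \<delta>])+
  have v: "0 < v" using c_const_pos n t \<delta> by (simp add: v_def)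
  have v2: "v\<^sup>2 = (c_const D V lam)\<^sup>2 * (real n * ((1 - \<delta>) * t / n) powr (2 * D))"
  proof -
    have "(y powr D)\<^sup>2 = y powr (2 * D)" for y
      by (simp add: power2_eq_square powr_add[symmetric])
    then show ?thesis by (simp add: v_def power_mult_distrib)
  qed
  have "prob E * bs_price \<kappa> v = (\<integral>\<omega>. indicator E \<omega> * bs_price \<kappa> v \<partial>P)"
    using E by simp
  also have "\<dots> \<le> (\<integral>\<omega>. bs_price \<kappa> (sqrt (time_change D V lam tau0 N t \<omega>)) \<partial>P)"
  proof (rule integral_mono)
    show "integrable P (\<lambda>\<omega>. indicator E \<omega> * bs_price \<kappa> v)"
      using E(1) by (intro integrable_mult_left integrable_real_indicator) (auto simp: emeasure_eq_measure)
    show "integrable P (\<lambda>\<omega>. bs_price \<kappa> (sqrt (time_change D V lam tau0 N t \<omega>)))"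
      by (rule call_price_eq_integral_bs_price(2)[OF t \<kappa>])
    fix \<omega> assume \<omega>: "\<omega> \<in> space P"
    show "indicator E \<omega> * bs_price \<kappa> v \<le> bs_price \<kappa> (sqrt (time_change D V lam tau0 N t \<omega>))"
    proof (cases "\<omega> \<in> E")
      case True
      then have "v\<^sup>2 \<le> time_change D V lam tau0 N t \<omega>"
        unfolding v2 using N_path[OF \<omega>] t D tau0 n \<delta>
        by (intro time_change_ge_on_grid) (auto simp: E_def)
      then have "bs_price \<kappa> v \<le> bs_price \<kappa> (sqrt (time_change D V lam tau0 N t \<omega>))"
        using v \<kappa> by (intro bs_price_mono real_le_rsqrt) auto
      then show ?thesis using True by simp
    qed (auto simp: bs_price_nonneg)
  qed
  also have "\<dots> = call_price P (log_price W (time_change D V lam tau0 N)) \<kappa> t"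
    by (rule call_price_eq_integral_bs_price(1)[OF t \<kappa>, symmetric])
  finally have "prob E * bs_price \<kappa> v \<le> call_price P (log_price W (time_change D V lam tau0 N)) \<kappa> t" .
  moreover have "prob E * (v * std_normal_density (\<kappa> / v + v / 2 + 2)) \<le> prob E * bs_price \<kappa> v"
    using bs_price_ge[OF \<kappa> v] by (intro mult_left_mono) auto
  ultimately show ?thesis unfolding E(2) by linarith
qed

end

section \<open>Asymptotics of the path cost\<close>

text \<open>
  In scaled time \<open>s\<close> and scaled strike \<open>s * x\<close>, having \<open>s * m\<close> jumps costs about \<open>s * m * ln m\<close>, and
  reaching the strike with the resulting variance costs \<open>s * x\<^sup>2 / (2 * m powr (1 - 2 * D))\<close>. At the
  minimum \<open>(1/2 - D) * x\<^sup>2 = m powr (2 - 2 * D) * ln m\<close> to leading order, with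
  \<open>ln m\<close> asymptotic to \<open>ln x / (1 - D)\<close>; inserting this for \<open>ln m\<close> gives the explicit \<open>m\<close> below.
  The total cost is then \<open>s * m * ln x / (1/2 - D)\<close>.
\<close>

definition jump_rate :: "real \<Rightarrow> real \<Rightarrow> real" where
  "jump_rate D x = ((1/2 - D) * (1 - D) * x\<^sup>2 / ln x) powr (1 / (2 - 2 * D))"

definition path_cost :: "real \<Rightarrow> real \<Rightarrow> real \<Rightarrow> real" where
  "path_cost D s x = s * jump_rate D x * ln x / (1/2 - D)"

lemma jump_rate_pos: "0 < D \<Longrightarrow> D < 1/2 \<Longrightarrow> 1 < x \<Longrightarrow> 0 < jump_rate D x"
  by (simp add: jump_rate_def)

lemma path_cost_pos: "0 < D \<Longrightarrow> D < 1/2 \<Longrightarrow> 0 < s \<Longrightarrow> 1 < x \<Longrightarrow> 0 < path_cost D s x"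
  by (simp add: path_cost_def jump_rate_pos)

lemma ln_jump_rate:
  assumes "0 < D" "D < 1/2" "1 < x"
  shows "ln (jump_rate D x) = (ln ((1/2 - D) * (1 - D)) + 2 * ln x - ln (ln x)) / (2 - 2 * D)"
proof -
  have "0 < (1/2 - D) * (1 - D)" "0 < x" "0 < ln x" using assms by auto
  moreover from this have "ln ((1/2 - D) * (1 - D) * x\<^sup>2 / ln x) = ln ((1/2 - D) * (1 - D)) + 2 * ln x - ln (ln x)"
    by (subst ln_divide_pos, simp, simp, subst ln_mult_pos, simp_all add: ln_realpow)
  ultimately show ?thesis by (simp add: jump_rate_def ln_powr)
qed

lemma jump_rate_powr:
  assumes "0 < D" "D < 1/2" "1 < x"
  shows "jump_rate D x powr (2 - 2 * D) = (1/2 - D) * (1 - D) * x\<^sup>2 / ln x"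
  using assms by (simp add: jump_rate_def powr_powr)

text \<open>
  For this choice of the number of jumps \<open>M\<close> the Chernoff parameter is \<open>ln x / (1 - D)\<close> and the main
  exponent equals the path cost exactly, not only asymptotically.
\<close>

lemma chernoff_exponent:
  assumes D: "0 < D" "D < 1/2" and s: "0 < s" and x: "1 < x"
  defines "q \<equiv> 1 - 2 * D" and "A \<equiv> (s * x)\<^sup>2 / (2 * s powr (2 * D))" and "M \<equiv> s * jump_rate D x"
  shows "q * A * M powr (- q - 1) = ln x / (1 - D)"
    and "(1 + q) * A * M powr (- q) = path_cost D s x"
proof -
  have m: "0 < jump_rate D x" using D x by (rule jump_rate_pos)
  have lx: "0 < ln x" using x by simp
  have M: "0 < M" using s m by (simp add: M_def)
  have e: "- q - 1 = - (2 - 2 * D)" by (simp add: q_def)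
  have "M powr (- q - 1) = 1 / (s powr (2 - 2 * D) * ((1/2 - D) * (1 - D) * x\<^sup>2 / ln x))"
    unfolding e powr_minus_divide M_def using s m
    by (simp only: powr_mult less_imp_le jump_rate_powr[OF D x])
  also have "s powr (2 - 2 * D) = s\<^sup>2 / s powr (2 * D)" using s by (simp add: powr_diff)
  finally have Mp: "M powr (- q - 1) = 1 / (s\<^sup>2 / s powr (2 * D) * ((1/2 - D) * (1 - D) * x\<^sup>2 / ln x))" .
  show 1: "q * A * M powr (- q - 1) = ln x / (1 - D)"
  proof -
    have "2 * e * (S * X / (2 * Sp)) * (1 / (S / Sp * (e * f * X / l))) = l / f"
      if "e \<noteq> 0" "f \<noteq> 0" "l \<noteq> 0" "S \<noteq> 0" "Sp \<noteq> 0" "X \<noteq> 0" for e f l S Sp X :: real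
      using that by (simp add: field_simps)
    from this[of "1/2 - D" "1 - D" "ln x" "s\<^sup>2" "s powr (2 * D)" "x\<^sup>2"] show ?thesis
      unfolding Mp using s x D lx by (simp add: A_def q_def power_mult_distrib)
  qed
  have "M powr (- q) = M powr (- q - 1) * M" using M by (simp add: powr_diff)
  then have "(1 + q) * A * M powr (- q) = (1 + q) / q * (q * A * M powr (- q - 1)) * M"
    using D by (simp add: q_def)
  also have "\<dots> = path_cost D s x"
  proof -
    have "2 * f / (2 * e) * (l / f) * (s * m) = s * m * l / e" if "e \<noteq> 0" "f \<noteq> 0" for e f l m :: real
      using that by (simp add: field_simps)
    moreover have "1 + q = 2 * (1 - D)" "q = 2 * (1/2 - D)" by (simp_all add: q_def)
    ultimately show ?thesis unfolding 1 using D by (simp only: M_def path_cost_def)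
  qed
  finally show "(1 + q) * A * M powr (- q) = path_cost D s x" .
qed

text \<open>
  The quotient is a constant multiple of \<open>ln x powr (b - 1)\<close> with \<open>b = 1 / (2 - 2 * D) < 1\<close>. This
  logarithmic factor is the only reason why the term \<open>lam * t * exp \<theta>\<close> of the Chernoff bound is
  negligible against the cost.
\<close>

lemma tendsto_powr_div_jump_rate:
  assumes D: "0 < D" "D < 1/2"
  shows "((\<lambda>x. x powr (1 / (1 - D)) / (jump_rate D x * ln x)) \<longlongrightarrow> 0) at_top"
proof -
  define b where "b = 1 / (2 - 2 * D)"
  define k where "k = ((1/2 - D) * (1 - D)) powr b"
  have b: "b < 1" using D by (simp add: b_def)
  have k: "0 < k" using D by (simp add: k_def)
  have "((\<lambda>L. L powr (b - 1) / k) \<longlongrightarrow> 0 / k) at_top"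
    using b k by (intro tendsto_divide tendsto_neg_powr filterlim_ident tendsto_const) auto
  then have "((\<lambda>x. ln x powr (b - 1) / k) \<longlongrightarrow> 0) at_top"
    using filterlim_compose[OF _ ln_at_top] by fastforce
  moreover have "eventually (\<lambda>x. ln x powr (b - 1) / k = x powr (1 / (1 - D)) / (jump_rate D x * ln x)) at_top"
    using eventually_gt_at_top[of 1]
  proof eventually_elim
    case (elim x)
    have "jump_rate D x = k * (x\<^sup>2) powr b / ln x powr b"
      using D elim by (simp add: jump_rate_def k_def b_def powr_mult powr_divide)
    also have "(x\<^sup>2) powr b = x powr (2 * b)"
      using elim by (simp add: powr_powr flip: powr_numeral)
    also have "2 * b = 1 / (1 - D)" using D by (simp add: b_def field_simps)
    finally have "jump_rate D x = k * x powr (1 / (1 - D)) / ln x powr b" .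
    then show ?case using elim k by (simp add: powr_diff)
  qed
  ultimately show ?thesis by (rule Lim_transform_eventually)
qed

lemma tendsto_ln_jump_rate_div_ln:
  assumes D: "0 < D" "D < 1/2"
  shows "((\<lambda>x. ln (jump_rate D x) / ln x) \<longlongrightarrow> 1 / (1 - D)) at_top"
proof -
  define C where "C = ln ((1/2 - D) * (1 - D))"
  have "((\<lambda>x::real. (C + 2 * ln x - ln (ln x)) / ln x) \<longlongrightarrow> 2) at_top" by real_asymp
  then have "((\<lambda>x::real. (C + 2 * ln x - ln (ln x)) / ln x / (2 - 2 * D)) \<longlongrightarrow> 2 / (2 - 2 * D)) at_top"
    using D by (intro tendsto_divide tendsto_const) auto
  moreover have "2 / (2 - 2 * D) = 1 / (1 - D)" using D by (simp add: field_simps)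
  moreover have "eventually (\<lambda>x. (C + 2 * ln x - ln (ln x)) / ln x / (2 - 2 * D) = ln (jump_rate D x) / ln x) at_top"
    using eventually_gt_at_top[of 1]
    by eventually_elim (use D in \<open>simp add: ln_jump_rate C_def\<close>)
  ultimately show ?thesis by (auto intro: Lim_transform_eventually)
qed

lemma tendsto_ceiling_div: "((\<lambda>y::real. real (nat \<lceil>y\<rceil>) / y) \<longlongrightarrow> 1) at_top"
proof (rule tendsto_sandwich)
  show "eventually (\<lambda>y::real. 1 \<le> real (nat \<lceil>y\<rceil>) / y) at_top"
    using eventually_gt_at_top[of 0] by eventually_elim (simp add: field_simps)
  show "eventually (\<lambda>y::real. real (nat \<lceil>y\<rceil>) / y \<le> 1 + 1 / y) at_top"
    using eventually_gt_at_top[of 0]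
  proof eventually_elim
    case (elim y)
    then have "real (nat \<lceil>y\<rceil>) \<le> y + 1" by linarith
    then show ?case using elim by (simp add: field_simps)
  qed
  show "((\<lambda>y::real. 1 + 1 / y) \<longlongrightarrow> 1) at_top" by real_asymp
qed auto

lemma ln_std_normal_density: "ln (std_normal_density y) = - ln (2 * pi) / 2 - y\<^sup>2 / 2"
  by (simp add: std_normal_density_def ln_div ln_sqrt)

text \<open>
  The hypotheses under which all error terms are negligible: large scaled strike, a number of jumps
  tending to infinity (so that rounding it does not matter), and times that are not too small
  compared with the strike (so that errors of order \<open>ln (1 / s)\<close> do not matter).
\<close>

locale large_deviation_regime =
  fixes D :: real and F :: "'z filter" and s x :: "'z \<Rightarrow> real"
  assumes D: "0 < D" "D < 1/2"
    and s_pos: "eventually (\<lambda>z. 0 < s z) F"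
    and x_at_top: "filterlim x at_top F"
    and jumps_at_top: "filterlim (\<lambda>z. s z * jump_rate D (x z)) at_top F"
    and ln_inverse_s_le: "eventually (\<lambda>z. ln (1 / s z) \<le> ln (x z) / (1 - D)) F"
begin

lemma D_lt_1: "D < 1" using D by simp

abbreviation "R z \<equiv> path_cost D (s z) (x z)"

lemma x_gt: "eventually (\<lambda>z. b < x z) F"
  using x_at_top by (simp add: filterlim_at_top_dense)

lemma ln_x_at_top: "filterlim (\<lambda>z. ln (x z)) at_top F"
  by (rule filterlim_compose[OF ln_at_top x_at_top])

lemma cost_pos: "eventually (\<lambda>z. 0 < R z) F"
  using s_pos x_gt[of 1] by eventually_elim (use D in \<open>simp add: path_cost_pos\<close>)

lemma cost_at_top: "filterlim R at_top F"
proof -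
  have "filterlim (\<lambda>z. 1 / (1/2 - D) * ((s z * jump_rate D (x z)) * ln (x z))) at_top F"
    using D by (intro filterlim_tendsto_pos_mult_at_top[OF tendsto_const]
      filterlim_at_top_mult_at_top[OF jumps_at_top ln_x_at_top]) auto
  then show ?thesis by (simp add: path_cost_def mult_ac)
qed

lemma tendsto_const_div_cost: "((\<lambda>z. b / R z) \<longlongrightarrow> 0) F"
  by (rule tendsto_divide_0[OF tendsto_const filterlim_at_top_imp_at_infinity[OF cost_at_top]])

lemma tendsto_const_div_sqrt_cost: "((\<lambda>z. b / sqrt (2 * R z)) \<longlongrightarrow> 0) F"
  by (rule tendsto_divide_0[OF tendsto_const filterlim_at_top_imp_at_infinity
    [OF filterlim_compose[OF sqrt_at_top filterlim_tendsto_pos_mult_at_top[OF tendsto_const _ cost_at_top]]]]) simp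

lemma tendsto_ln_cost_div_cost: "((\<lambda>z. ln (2 * R z) / R z) \<longlongrightarrow> 0) F"
proof -
  have "((\<lambda>y::real. ln (2 * y) / y) \<longlongrightarrow> 0) at_top" by real_asymp
  then show ?thesis using cost_at_top by (rule filterlim_compose)
qed

lemma tendsto_ln_x_div_cost: "((\<lambda>z. ln (x z) / R z) \<longlongrightarrow> 0) F"
proof (rule Lim_transform_eventually)
  show "((\<lambda>z. (1/2 - D) / (s z * jump_rate D (x z))) \<longlongrightarrow> 0) F"
    by (rule tendsto_divide_0[OF tendsto_const filterlim_at_top_imp_at_infinity[OF jumps_at_top]])
  show "eventually (\<lambda>z. (1/2 - D) / (s z * jump_rate D (x z)) = ln (x z) / R z) F"
    using x_gt[of 1] by eventually_elim (simp add: path_cost_def)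
qed

lemma tendsto_jump_entropy_div_cost: "((\<lambda>z. s z * x z powr (1 / (1 - D)) / R z) \<longlongrightarrow> 0) F"
proof (rule Lim_transform_eventually)
  show "((\<lambda>z. (1/2 - D) * (x z powr (1 / (1 - D)) / (jump_rate D (x z) * ln (x z)))) \<longlongrightarrow> 0) F"
    using tendsto_mult_right_zero[OF filterlim_compose[OF tendsto_powr_div_jump_rate[OF D] x_at_top]] .
  show "eventually (\<lambda>z. (1/2 - D) * (x z powr (1 / (1 - D)) / (jump_rate D (x z) * ln (x z))) =
      s z * x z powr (1 / (1 - D)) / R z) F"
    using s_pos by eventually_elim (simp add: path_cost_def)
qed

lemma tendsto_strike_div_cost: "((\<lambda>z. s z * x z / R z) \<longlongrightarrow> 0) F"
proof (rule tendsto_sandwich[OF _ _ tendsto_const tendsto_jump_entropy_div_cost])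
  show "eventually (\<lambda>z. 0 \<le> s z * x z / R z) F"
    using s_pos x_gt[of 1] cost_pos by eventually_elim auto
  show "eventually (\<lambda>z. s z * x z / R z \<le> s z * x z powr (1 / (1 - D)) / R z) F"
    using s_pos x_gt[of 1] cost_pos
  proof eventually_elim
    case (elim z)
    have "x z powr 1 \<le> x z powr (1 / (1 - D))" using elim D by (intro powr_mono) auto
    then show ?case using elim by (intro divide_right_mono mult_left_mono) auto
  qed
qed

lemma tendsto_s_div_cost: "((\<lambda>z. s z / R z) \<longlongrightarrow> 0) F"
proof (rule tendsto_sandwich[OF _ _ tendsto_const tendsto_strike_div_cost])
  show "eventually (\<lambda>z. 0 \<le> s z / R z) F"
    using s_pos cost_pos by eventually_elim auto
  show "eventually (\<lambda>z. s z / R z \<le> s z * x z / R z) F"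
    using s_pos x_gt[of 1] cost_pos by eventually_elim (simp add: divide_right_mono)
qed

text \<open>
  The left-hand side is the Chernoff bound, with logarithm \<open>- R\<close> to leading order. The right-hand side
  is the lower bound \<open>bs_price_ge\<close> at the asymptotic volatility enlarged by \<open>1 + \<epsilon>\<close>, with logarithm
  \<open>- R / (1 + \<epsilon>)\<^sup>2\<close> to leading order. After division by \<open>R\<close> all other terms tend to zero.
\<close>

lemma upper_exponent_comparison:
  assumes "0 < \<epsilon>" "0 < lam" "0 < a"
  defines "v z \<equiv> (1 + \<epsilon>) * (s z * x z / sqrt (2 * R z))"
  shows "eventually (\<lambda>z. exp (s z * x z / 2 - R z + ln (x z) / (1 - D)
      + lam * (s z / a) * (exp (ln (x z) / (1 - D)) - 1))
      \<le> v z * std_normal_density (s z * x z / v z + v z / 2 + 2)) F"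
proof -
  define Z where "Z z = 1 / (1 + \<epsilon>) + (1 + \<epsilon>) / 4 * (s z * x z / R z) + 2 / sqrt (2 * R z)" for z
  \<comment> \<open>The difference of the logarithms of both sides, up to bounds, divided by the cost.\<close>
  define G where "G z = (1/2) * (s z * x z / R z) - 1 + 2 / (1 - D) * (ln (x z) / R z)
    + lam / a * (s z * x z powr (1 / (1 - D)) / R z) + (1/2) * (ln (2 * R z) / R z)
    + (ln (2 * pi) / 2) / R z + (Z z)\<^sup>2" for z
  have Z: "(Z \<longlongrightarrow> 1 / (1 + \<epsilon>) + (1 + \<epsilon>) / 4 * 0 + 0) F"
    unfolding Z_def by (intro tendsto_intros tendsto_strike_div_cost tendsto_const_div_sqrt_cost)
  have "(G \<longlongrightarrow> (1/2) * 0 - 1 + 2 / (1 - D) * 0 + lam / a * 0 + (1/2) * 0 + 0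
      + (1 / (1 + \<epsilon>) + (1 + \<epsilon>) / 4 * 0 + 0)\<^sup>2) F"
    unfolding G_def
    by (intro tendsto_add tendsto_diff tendsto_mult tendsto_const tendsto_power Z tendsto_strike_div_cost
      tendsto_ln_x_div_cost tendsto_jump_entropy_div_cost tendsto_ln_cost_div_cost tendsto_const_div_cost)
  moreover have "(1 / (1 + \<epsilon>) + (1 + \<epsilon>) / 4 * 0 + 0)\<^sup>2 < 1"
    using assms by (simp add: power_strict_mono[of _ 1 2, simplified] abs_square_less_1)
  ultimately have G: "eventually (\<lambda>z. G z < 0) F"
    by (intro order_tendstoD(2)) auto
  show ?thesis
    using G s_pos x_gt[of 1] cost_pos ln_inverse_s_le
  proof eventually_elim
    case (elim z)
    define rt where "rt = sqrt (2 * R z)"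
    have rt: "0 < rt" "rt\<^sup>2 = 2 * R z" using elim by (auto simp: rt_def)
    have k: "0 < s z * x z" using elim by simp
    have v: "0 < v z" using k rt assms by (simp add: v_def rt_def[symmetric])
    have vrt: "v z = (1 + \<epsilon>) * (s z * x z / rt)" by (simp add: v_def rt_def)
    have "u / (e * (u / r)) = r / e" if "u \<noteq> 0" "e \<noteq> 0" "r \<noteq> 0" for u e r :: real
      using that by simp
    then have kv: "s z * x z / v z = rt / (1 + \<epsilon>)"
      unfolding vrt using k rt assms(1) by (smt (verit))
    have vh: "v z / 2 = rt * ((1 + \<epsilon>) / 4 * (s z * x z / R z))"
    proof -
      have "e * (u / r) / 2 = r * (e / 4 * (u / (r\<^sup>2 / 2)))" if "r \<noteq> 0" for u e r :: real
        using that by (simp add: power2_eq_square)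
      moreover have "R z = rt\<^sup>2 / 2" using rt by simp
      ultimately show ?thesis unfolding vrt using rt by simp
    qed
    have "s z * x z / v z + v z / 2 + 2 = rt * Z z"
      unfolding kv vh Z_def rt_def[symmetric] distrib_left using rt(1) by simp
    then have sq: "(s z * x z / v z + v z / 2 + 2)\<^sup>2 / 2 = R z * (Z z)\<^sup>2"
      using rt by (simp add: power_mult_distrib)
    have lnv: "ln (v z) = ln (1 + \<epsilon>) + ln (s z) + ln (x z) - ln (2 * R z) / 2"
    proof -
      have "ln (v z) = ln (1 + \<epsilon>) + ln (s z * x z / sqrt (2 * R z))"
        unfolding v_def using k elim assms by (intro ln_mult_pos) auto
      also have "ln (s z * x z / sqrt (2 * R z)) = ln (s z * x z) - ln (sqrt (2 * R z))"
        using k elim by (intro ln_divide_pos) auto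
      also have "ln (s z * x z) = ln (s z) + ln (x z)" using elim by (intro ln_mult_pos) auto
      finally show ?thesis using elim by (simp add: ln_sqrt)
    qed
    have lns: "ln (1 / s z) = - ln (s z)" using elim by (simp add: ln_div)
    have lnv_ge: "- ln (x z) / (1 - D) - ln (2 * R z) / 2 \<le> ln (v z)"
    proof -
      have "0 \<le> ln (1 + \<epsilon>)" "0 \<le> ln (x z)" using elim assms by auto
      then show ?thesis unfolding lnv using elim(5) unfolding lns by linarith
    qed
    have ex: "exp (ln (x z) / (1 - D)) = x z powr (1 / (1 - D))" using elim by (simp add: powr_def)
    have "R z * G z < 0" using elim by (simp add: mult_less_0_iff)
    moreover have "R z * G z = s z * x z / 2 - R z + 2 * (ln (x z) / (1 - D))
       + lam * (s z / a) * x z powr (1 / (1 - D)) + ln (2 * R z) / 2 + ln (2 * pi) / 2 + R z * (Z z)\<^sup>2"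
    proof -
      have "R z * (b * (u / R z)) = b * u" "R z * (u / R z) = u" for b u using elim by simp_all
      then show ?thesis unfolding G_def by (simp only: distrib_left right_diff_distrib) simp
    qed
    moreover have "lam * (s z / a) * (exp (ln (x z) / (1 - D)) - 1) \<le> lam * (s z / a) * x z powr (1 / (1 - D))"
      unfolding ex using elim assms by (intro mult_left_mono) auto
    ultimately have "s z * x z / 2 - R z + ln (x z) / (1 - D) + lam * (s z / a) * (exp (ln (x z) / (1 - D)) - 1)
       \<le> ln (v z) + ln (std_normal_density (s z * x z / v z + v z / 2 + 2))"
      unfolding ln_std_normal_density sq using lnv_ge by linarith
    also have "\<dots> = ln (v z * std_normal_density (s z * x z / v z + v z / 2 + 2))"
      using v by (intro ln_mult_pos[symmetric]) (auto intro: normal_density_pos)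
    finally show ?case using v normal_density_pos[of 1] by (simp add: ln_ge_iff[symmetric])
  qed
qed

text \<open>
  For \<open>\<delta> = 0\<close> the sum is \<open>1\<close>: its terms are the shares of the jumps and of the Brownian motion in
  the path cost. By continuity a small \<open>\<delta>\<close> loses arbitrarily little.
\<close>

lemma ex_small_gap:
  assumes "1 < B"
  obtains \<delta> where "0 < \<delta>" "\<delta> < 1" "(1/2 - D) / (1 - D) + ((1 - \<delta>) powr - D / sqrt (2 * (1 - D)))\<^sup>2 < B"
proof -
  have "((\<lambda>\<delta>. (1/2 - D) / (1 - D) + ((1 - \<delta>) powr - D / sqrt (2 * (1 - D)))\<^sup>2) \<longlongrightarrow>
      (1/2 - D) / (1 - D) + ((1 - 0) powr - D / sqrt (2 * (1 - D)))\<^sup>2) (at_right 0)"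
    using D by (intro tendsto_intros) auto
  moreover have "(1/2 - D) / (1 - D) + ((1 - 0) powr - D / sqrt (2 * (1 - D)))\<^sup>2 = 1"
    using D by (simp add: power_divide field_simps)
  ultimately have "eventually (\<lambda>\<delta>. (1/2 - D) / (1 - D) + ((1 - \<delta>) powr - D / sqrt (2 * (1 - D)))\<^sup>2 < B) (at_right 0)"
    using assms by (intro order_tendstoD(2)) auto
  moreover have "eventually (\<lambda>\<delta>::real. \<delta> \<in> {0<..<1}) (at_right 0)" by (rule eventually_at_right_real) simp
  ultimately have "eventually (\<lambda>\<delta>. (1/2 - D) / (1 - D) + ((1 - \<delta>) powr - D / sqrt (2 * (1 - D)))\<^sup>2 < B \<and> \<delta> \<in> {0<..<1}) (at_right 0)"
    by (rule eventually_conj)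
  then obtain \<delta> where "(1/2 - D) / (1 - D) + ((1 - \<delta>) powr - D / sqrt (2 * (1 - D)))\<^sup>2 < B \<and> \<delta> \<in> {0<..<1}"
    using eventually_happens'[of "at_right (0::real)"] by (metis (mono_tags, lifting) trivial_limit_at_right_real)
  then show ?thesis using that by auto
qed

text \<open>
  The right-hand side is the lower bound for the call price with the optimal number of jumps, rounded
  up. Divided by \<open>R\<close>, its logarithm tends to the negative of the sum in the assumption on \<open>B\<close>: the
  first term comes from the Poisson probability, where \<open>ln (jump_rate D x)\<close> is asymptotic to
  \<open>ln x / (1 - D)\<close>, and the second one from the Gaussian density.
\<close>

lemma lower_exponent_comparison:
  assumes "0 < lam" "0 < a" and \<delta>: "0 < \<delta>" "\<delta> < 1"
    and B: "(1/2 - D) / (1 - D) + ((1 - \<delta>) powr - D / sqrt (2 * (1 - D)))\<^sup>2 < B"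
  defines "n z \<equiv> nat \<lceil>s z * jump_rate D (x z)\<rceil>"
  defines "v z \<equiv> a powr D * sqrt (n z) * ((1 - \<delta>) * (s z / a) / n z) powr D"
  shows "eventually (\<lambda>z. exp (s z * x z / 2 - B * R z) \<le>
      exp (- lam * (s z / a)) * (lam * \<delta> * (s z / a) / n z) ^ n z
      * (v z * std_normal_density (s z * x z / v z + v z / 2 + 2))) F"
proof -
  \<comment> \<open>The effect of rounding the number of jumps; it tends to one.\<close>
  define g where "g z = real (n z) / (s z * jump_rate D (x z))" for z
  have g: "(g \<longlongrightarrow> 1) F"
    unfolding g_def n_def by (rule filterlim_compose[OF tendsto_ceiling_div jumps_at_top])
  define b where "b = ln (a / (lam * \<delta>))"
  \<comment> \<open>The Poisson part of the cost, relative to the total cost.\<close>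
  define H where "H z = g z * (1/2 - D) * (ln (g z) / ln (x z) + ln (jump_rate D (x z)) / ln (x z) + b / ln (x z))" for z
  have "(H \<longlongrightarrow> 1 * (1/2 - D) * (0 + 1 / (1 - D) + 0)) F"
    unfolding H_def
  proof (intro tendsto_add tendsto_mult g tendsto_const)
    show "((\<lambda>z. ln (jump_rate D (x z)) / ln (x z)) \<longlongrightarrow> 1 / (1 - D)) F"
      by (rule filterlim_compose[OF tendsto_ln_jump_rate_div_ln[OF D] x_at_top])
    show "((\<lambda>z. b / ln (x z)) \<longlongrightarrow> 0) F"
      by (rule tendsto_divide_0[OF tendsto_const filterlim_at_top_imp_at_infinity[OF ln_x_at_top]])
    show "((\<lambda>z. ln (g z) / ln (x z)) \<longlongrightarrow> 0) F"
      by (rule tendsto_divide_0[OF tendsto_ln[OF g] filterlim_at_top_imp_at_infinity[OF ln_x_at_top]]) simp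
  qed
  then have H: "(H \<longlongrightarrow> (1/2 - D) / (1 - D)) F" by simp
  \<comment> \<open>The leading part of the Gaussian argument, relative to the square root of twice the cost.\<close>
  define Y where "Y z = (1 - \<delta>) powr - D / sqrt (2 * (1 - D)) * g z powr - (1/2 - D)" for z
  have Y: "(Y \<longlongrightarrow> (1 - \<delta>) powr - D / sqrt (2 * (1 - D)) * 1 powr - (1/2 - D)) F"
    unfolding Y_def by (intro tendsto_mult tendsto_const tendsto_powr g) auto
  define y where "y = (1 - \<delta>) powr - D / sqrt (2 * (1 - D))"
  have y: "0 < y" using \<delta> D by (simp add: y_def)
  have Y: "(Y \<longlongrightarrow> y) F" using Y by (simp add: y_def)
  define Z where "Z z = Y z + (1/4) * (s z * x z / R z) / Y z + 2 / sqrt (2 * R z)" for z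
  have "(Z \<longlongrightarrow> y + (1/4) * 0 / y + 0) F"
    unfolding Z_def using y
    by (intro tendsto_add tendsto_mult tendsto_divide tendsto_const Y tendsto_strike_div_cost tendsto_const_div_sqrt_cost) auto
  then have Z: "(Z \<longlongrightarrow> y) F" by simp
  define G where "G z = (1/2) * (s z * x z / R z) - B + lam / a * (s z / R z) + H z
    + (- D * ln (1 - \<delta>) / R z) + 1 / (1 - D) * (ln (x z) / R z) + (ln (2 * pi) / 2) / R z + (Z z)\<^sup>2" for z
  have "(G \<longlongrightarrow> (1/2) * 0 - B + lam / a * 0 + (1/2 - D) / (1 - D) + 0 + 1 / (1 - D) * 0 + 0 + y\<^sup>2) F"
    unfolding G_def
    by (intro tendsto_add tendsto_diff tendsto_mult tendsto_const tendsto_power Z H tendsto_strike_div_cost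
      tendsto_ln_x_div_cost tendsto_s_div_cost tendsto_const_div_cost)
  moreover have "(1/2 - D) / (1 - D) + y\<^sup>2 < B" using B by (simp add: y_def)
  ultimately have G: "eventually (\<lambda>z. G z < 0) F" by (intro order_tendstoD(2)) auto
  have big: "eventually (\<lambda>z. 0 < s z * jump_rate D (x z)) F"
    using jumps_at_top by (simp add: filterlim_at_top_dense)
  show ?thesis
    using G s_pos x_gt[of 1] cost_pos ln_inverse_s_le big
  proof eventually_elim
    case (elim z)
    define M where "M = s z * jump_rate D (x z)"
    have M: "0 < M" using elim by (simp add: M_def)
    have n1: "1 \<le> real (n z)" 
    proof -
      have "0 < \<lceil>M\<rceil>" using M by simp
      then show ?thesis unfolding n_def M_def[symmetric] by linarith
    qed
    then have n0: "0 < n z" "0 < real (n z)" by auto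
    have g0: "0 < g z" using n0 elim by (simp add: g_def)
    have ng: "real (n z) = g z * M" using M by (simp add: g_def flip: M_def)
    have m: "0 < jump_rate D (x z)" using elim D by (intro jump_rate_pos) auto
    define rt where "rt = sqrt (2 * R z)"
    have rt: "0 < rt" "rt\<^sup>2 = 2 * R z" using elim by (auto simp: rt_def)
    have k: "0 < s z * x z" using elim by simp
    have lx: "0 < ln (x z)" using elim by simp
    have vform: "v z = (1 - \<delta>) powr D * s z powr D * real (n z) powr (1/2 - D)"
    proof -
      have "a powr D * sqrt k * ((1 - \<delta>) * (u / a) / k) powr D = (1 - \<delta>) powr D * u powr D * k powr (1/2 - D)"
        if "0 < u" "0 < k" for u k :: real
        using that \<delta> assms(2) by (simp add: powr_mult powr_divide powr_diff powr_half_sqrt)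
      then show ?thesis using elim(2) n0(2) by (simp only: v_def)
    qed
    have v: "0 < v z" using vform \<delta> elim n0 by simp
    have Y0: "0 < Y z" using y g0 unfolding Y_def y_def[symmetric] by simp
    have kv: "s z * x z / v z = rt * Y z"
    proof -
      have "(s z * x z / v z)\<^sup>2 = (rt * Y z)\<^sup>2"
      proof -
        have p2: "(u powr e)\<^sup>2 = u powr (2 * e)" for u e :: real
          by (simp add: power2_eq_square powr_add[symmetric])
        define Sp Gp Mp d where "Sp = s z powr (2 * D)" and "Gp = g z powr (1 - 2 * D)"
          and "Mp = M powr (1 - 2 * D)" and "d = (1 - \<delta>) powr (2 * D)"
        have "(1 + (1 - 2 * D)) * ((s z * x z)\<^sup>2 / (2 * Sp)) * (1 / Mp) = R z"
          using chernoff_exponent(2)[OF D elim(2,3)]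
          unfolding M_def[symmetric] powr_minus_divide Sp_def[symmetric] Mp_def[symmetric] .
        moreover have "(1 + (1 - 2 * D)) * ((s z * x z)\<^sup>2 / (2 * Sp)) * (1 / Mp)
            = (1 - D) * ((s z * x z)\<^sup>2 / Sp * (1 / Mp))"
        proof -
          have "2 * f * (u / (2 * Sp)) * (1 / Mp) = f * (u / Sp * (1 / Mp))" for f u by simp
          moreover have "1 + (1 - 2 * D) = 2 * (1 - D)" by simp
          ultimately show ?thesis by (simp only:)
        qed
        ultimately have R: "(s z * x z)\<^sup>2 / Sp * (1 / Mp) = R z / (1 - D)"
          using D by (metis nonzero_mult_div_cancel_left less_irrefl diff_gt_0_iff_gt D_lt_1)
        have "(v z)\<^sup>2 = d * Sp * (Gp * Mp)"
          unfolding vform power_mult_distrib p2 ng d_def Sp_def Gp_def Mp_def using g0 M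
          by (simp add: powr_mult)
        then have "(s z * x z / v z)\<^sup>2 = (1 / d) * (1 / Gp) * ((s z * x z)\<^sup>2 / Sp * (1 / Mp))"
          by (simp add: power_divide)
        also have "\<dots> = (1 / d) * (1 / Gp) * (R z / (1 - D))" unfolding R ..
        also have "\<dots> = 2 * R z * ((1 / d) / (2 * (1 - D)) * (1 / Gp))"
        proof -
          have "(1 / d) * (1 / Gp) * (u / f) = 2 * u * ((1 / d) / (2 * f) * (1 / Gp))" for u f by simp
          then show ?thesis .
        qed
        also have "\<dots> = (rt * Y z)\<^sup>2"
        proof -
          have "((1 - \<delta>) powr - D)\<^sup>2 = 1 / d" "(g z powr - (1/2 - D))\<^sup>2 = 1 / Gp"
            unfolding p2 d_def Gp_def powr_minus_divide[symmetric] by simp_all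
          moreover have "(sqrt (2 * (1 - D)))\<^sup>2 = 2 * (1 - D)" using D by simp
          ultimately show ?thesis
            unfolding Y_def power_mult_distrib power_divide rt(2) by (simp only:)
        qed
        finally show ?thesis .
      qed
      then show ?thesis using k v rt Y0 by (simp add: power2_eq_iff_nonneg)
    qed
    have vv: "v z / 2 = rt * ((1/4) * (s z * x z / R z) / Y z)"
    proof -
      have "R z = rt\<^sup>2 / 2" using rt by simp
      moreover have "v z = s z * x z / (rt * Y z)" using kv v rt Y0 by (simp add: field_simps)
      moreover have "u / (rt * Y z) / 2 = rt * ((1/4) * (u / (rt\<^sup>2 / 2)) / Y z)" for u
        using rt(1) by (simp add: power2_eq_square)
      ultimately show ?thesis by (simp only:)
    qed
    have "s z * x z / v z + v z / 2 + 2 = rt * Z z"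
      unfolding kv vv Z_def rt_def[symmetric] distrib_left using rt(1) by simp
    then have sq: "(s z * x z / v z + v z / 2 + 2)\<^sup>2 / 2 = R z * (Z z)\<^sup>2"
      using rt by (simp add: power_mult_distrib)
    have lnv: "D * ln (1 - \<delta>) - ln (x z) / (1 - D) \<le> ln (v z)"
    proof -
      have "ln (v z) = D * ln (1 - \<delta>) + D * ln (s z) + (1/2 - D) * ln (n z)"
        unfolding vform using \<delta> elim n0 by (simp add: ln_mult_pos ln_powr)
      moreover have "0 \<le> (1/2 - D) * ln (n z)" using n1 D by (intro mult_nonneg_nonneg) auto
      moreover have "- (ln (x z) / (1 - D)) \<le> D * ln (s z)"
      proof -
        have "ln (1 / s z) = - ln (s z)" using elim by (simp add: ln_div)
        then have "D * (- ln (s z)) \<le> D * (ln (x z) / (1 - D))"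
          using elim D by (intro mult_left_mono) auto
        also have "\<dots> \<le> 1 * (ln (x z) / (1 - D))" using D lx by (intro mult_right_mono) auto
        finally show ?thesis by simp
      qed
      ultimately show ?thesis by linarith
    qed
    define p where "p = lam * \<delta> * (s z / a) / n z"
    have p: "0 < p" using assms elim n0 \<delta> by (simp add: p_def)
    have lnp: "real (n z) * ln p = - (R z * H z)"
    proof -
      have "1 / p = g z * jump_rate D (x z) * (a / (lam * \<delta>))"
      proof -
        have *: "1 / (lam * \<delta> * (u / a) / (h * (u * w))) = h * w * (a / (lam * \<delta>))" if "u \<noteq> 0" for u h w
          using that by simp
        show ?thesis unfolding p_def ng M_def by (rule *) (use elim(2) in simp)
      qed
      moreover have "ln (g z * jump_rate D (x z) * (a / (lam * \<delta>))) = ln (g z) + ln (jump_rate D (x z)) + b"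
        using g0 m assms \<delta> by (subst ln_mult_pos, simp, simp, subst ln_mult_pos, simp_all add: b_def)
      moreover have "ln (1 / p) = - ln p" using p by (simp add: ln_div)
      ultimately have "ln p = - (ln (g z) + ln (jump_rate D (x z)) + b)" by simp
      moreover have "R z * H z = g z * M * (ln (g z) + ln (jump_rate D (x z)) + b)"
        using lx D by (simp add: H_def path_cost_def M_def add_divide_distrib[symmetric])
      ultimately show ?thesis unfolding ng by (simp only: mult_minus_right)
    qed
    have "R z * G z < 0" using elim by (simp add: mult_less_0_iff)
    moreover have "R z * G z = s z * x z / 2 - B * R z + lam * (s z / a) + R z * H z
       - D * ln (1 - \<delta>) + ln (x z) / (1 - D) + ln (2 * pi) / 2 + R z * (Z z)\<^sup>2"
    proof -
      have "R z * (b * (u / R z)) = b * u" "R z * (u / R z) = u" for b u using elim by simp_all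
      then show ?thesis unfolding G_def by (simp only: distrib_left right_diff_distrib) simp
    qed
    ultimately have "s z * x z / 2 - B * R z \<le> - lam * (s z / a) + real (n z) * ln p + (ln (v z)
        + ln (std_normal_density (s z * x z / v z + v z / 2 + 2)))"
      unfolding ln_std_normal_density sq lnp using lnv by linarith
    then have "exp (s z * x z / 2 - B * R z) \<le> exp (- lam * (s z / a) + real (n z) * ln p + (ln (v z)
        + ln (std_normal_density (s z * x z / v z + v z / 2 + 2))))" by simp
    also have "\<dots> = exp (- lam * (s z / a)) * p ^ n z * (v z * std_normal_density (s z * x z / v z + v z / 2 + 2))"
    proof -
      have "exp (real (n z) * ln p) = p ^ n z" using p by (simp add: exp_of_nat_mult)
      then show ?thesis
        using v by (simp only: exp_add exp_ln normal_density_pos zero_less_one)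
    qed
    finally show ?case by (simp add: p_def)
  qed
qed

end

section \<open>The implied volatility at large strikes\<close>

text \<open>
  The sets \<open>\<kappa> > M * kappa2 D (a * t)\<close> with \<open>0 < t < T\<close>, for growing \<open>M\<close>, form a filter base. An assertion
  that holds eventually along this filter holds uniformly on one of these sets.
\<close>

definition strike_filter :: "real \<Rightarrow> real \<Rightarrow> real \<Rightarrow> (real \<times> real) filter" where
  "strike_filter D a T =
     inf (filtercomap (\<lambda>z. fst z / kappa2 D (a * snd z)) at_top)
       (principal {z. 0 < snd z \<and> snd z < T \<and> 0 < fst z})"

lemma kappa2_pos: "0 < t \<Longrightarrow> t < 1 \<Longrightarrow> 0 < kappa2 D t"
  by (simp add: kappa2_def)

lemma eventually_strike_filterD:
  assumes "eventually Q (strike_filter D a T)" "0 < a" "a * T < 1"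
  shows "\<exists>M>0. \<forall>(\<kappa>, t) \<in> {(\<kappa>, t). 0 < t \<and> t < T \<and> \<kappa> > M * kappa2 D (a * t)}. 0 < \<kappa> \<and> Q (\<kappa>, t)"
proof -
  from assms(1) obtain B where B: "\<And>z. B \<le> fst z / kappa2 D (a * snd z) \<Longrightarrow>
      0 < snd z \<and> snd z < T \<and> 0 < fst z \<Longrightarrow> Q z"
    unfolding strike_filter_def eventually_inf_principal eventually_filtercomap_at_top_linorder
    by blast
  have "0 < \<kappa> \<and> Q (\<kappa>, t)" if "0 < t" "t < T" "max B 1 * kappa2 D (a * t) < \<kappa>" for \<kappa> t
  proof -
    have "a * t < a * T" using that assms(2) by simp
    then have "a * t < 1" using assms(3) by linarith
    then have k: "0 < kappa2 D (a * t)" using that assms by (intro kappa2_pos) auto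
    have "0 < max B 1 * kappa2 D (a * t)" using k by simp
    then have \<kappa>: "0 < \<kappa>" using that by linarith
    have "B * kappa2 D (a * t) \<le> max B 1 * kappa2 D (a * t)" using k by (intro mult_right_mono) auto
    then have "B * kappa2 D (a * t) \<le> \<kappa>" using that by linarith
    then have "B \<le> \<kappa> / kappa2 D (a * t)" using k by (simp add: le_divide_eq)
    then show ?thesis using B[of "(\<kappa>, t)"] that \<kappa> by simp
  qed
  then show ?thesis by (intro exI[of _ "max B 1"]) auto
qed

text \<open>
  What \<open>kappa2\<close> is made for. With \<open>l = ln (1 / s)\<close> the scaled strike is \<open>x = r * s powr (D - 1) * sqrt l\<close>.
  Hence \<open>ln x\<close> is comparable to \<open>l\<close>, and in \<open>s powr (2 - 2 * D) * x\<^sup>2 = r\<^sup>2 * l\<close>, which up to a factor of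
  order \<open>ln x\<close> is a power of the number of jumps, the dependence on \<open>s\<close> is logarithmic. Since \<open>l\<close> is bounded
  below by \<open>l0 > 0\<close>, what remains is a function of \<open>r\<close> alone that tends to infinity.
\<close>

lemma strike_ratio_bounds:
  assumes D: "0 < D" "D < 1/2" and s: "0 < s" "s \<le> S" "S < 1" and \<kappa>: "0 < \<kappa>"
    and r: "1 \<le> \<kappa> / kappa2 D s" "1 \<le> (\<kappa> / kappa2 D s)\<^sup>2 * ln (1 / S)"
  defines "r \<equiv> \<kappa> / kappa2 D s" and "l0 \<equiv> ln (1 / S)"
  shows "r * sqrt l0 \<le> \<kappa> / s"
    and "ln (1 / s) \<le> ln (\<kappa> / s) / (1 - D)"
    and "((1/2 - D) * (1 - D) * r\<^sup>2 / (ln r / l0 + 2)) powr (1 / (2 - 2 * D)) \<le> s * jump_rate D (\<kappa> / s)"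
proof -
  define l where "l = ln (1 / s)"
  define x where "x = \<kappa> / s"
  have S: "0 < S" using s by simp
  have l0: "0 < l0" using S s by (simp add: l0_def)
  have l: "l0 \<le> l" unfolding l_def l0_def using s S by (subst ln_le_cancel_iff) (auto simp: field_simps)
  have lpos: "0 < l" using l l0 by simp
  have lns: "ln s = - l" using s by (simp add: l_def ln_div)
  have k2: "kappa2 D s = s powr D * sqrt l" by (simp add: kappa2_def l_def)
  have r1: "1 \<le> r" "1 \<le> r\<^sup>2 * l0" using r by (simp_all add: r_def l0_def)
  have \<kappa>_eq: "\<kappa> = r * (s powr D * sqrt l)" using s lpos unfolding r_def k2 by simp
  have x_eq: "x = r * s powr (D - 1) * sqrt l"
    unfolding x_def \<kappa>_eq using s by (simp add: powr_diff)
  have x0: "0 < x" using \<kappa> s by (simp add: x_def)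
  have "1 powr (D - 1) \<le> s powr (D - 1)" using s D by (intro powr_mono2') auto
  then have "r * 1 * sqrt l0 \<le> r * s powr (D - 1) * sqrt l"
    using r1 l l0 by (intro mult_mono) auto
  then show "r * sqrt l0 \<le> \<kappa> / s" using x_eq by (simp add: x_def)
  have lnx: "ln x = ln r + (1 - D) * l + ln l / 2"
  proof -
    have "ln x = ln r + (D - 1) * ln s + ln (sqrt l)"
      unfolding x_eq using r1 s lpos by (simp add: ln_mult_pos ln_powr)
    then show ?thesis using lpos by (simp add: lns ln_sqrt algebra_simps)
  qed
  have half: "0 \<le> ln r + ln l / 2"
  proof -
    have "r\<^sup>2 * l0 \<le> r\<^sup>2 * l" using l by (intro mult_left_mono) auto
    then have "1 \<le> r\<^sup>2 * l" using r1(2) by (rule order_trans[rotated])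
    then have "0 \<le> ln (r\<^sup>2 * l)" by (rule ln_ge_zero)
    also have "\<dots> = 2 * ln r + ln l" using r1 lpos by (simp add: ln_mult_pos ln_realpow)
    finally show ?thesis by simp
  qed
  then have "(1 - D) * l \<le> ln x" using lnx by simp
  then show "ln (1 / s) \<le> ln (\<kappa> / s) / (1 - D)"
    using D unfolding l_def[symmetric] x_def[symmetric] by (simp add: pos_le_divide_eq mult.commute)
  have "0 < (1 - D) * l" using lpos D by simp
  then have lx: "0 < ln x" using \<open>(1 - D) * l \<le> ln x\<close> by linarith
  have lx_le: "ln x \<le> ln r + 2 * l"
  proof -
    have "ln l \<le> l - 1" using lpos by (rule ln_le_minus_one)
    moreover have "(1 - D) * l \<le> 1 * l" using D lpos by (intro mult_right_mono) auto
    ultimately show ?thesis unfolding lnx using lpos by linarith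
  qed
  define p where "p = (1/2 - D) * (1 - D)"
  have p: "0 < p" using D by (simp add: p_def)
  have "s powr (2 - 2 * D) * x\<^sup>2 = r\<^sup>2 * l"
  proof -
    have "(s powr (D - 1))\<^sup>2 = s powr (- (2 - 2 * D))"
      by (simp add: power2_eq_square powr_add[symmetric])
    then have "x\<^sup>2 = r\<^sup>2 * s powr (- (2 - 2 * D)) * l"
      unfolding x_eq using lpos by (simp add: power_mult_distrib)
    moreover have "s powr (2 - 2 * D) * s powr (- (2 - 2 * D)) = 1"
      using s by (simp add: powr_add[symmetric])
    ultimately show ?thesis by (simp add: mult_ac)
  qed
  then have sx: "s powr (2 - 2 * D) * (p * x\<^sup>2 / ln x) = p * r\<^sup>2 * (l / ln x)"
    by (simp add: mult_ac)
  have "s = (s powr (2 - 2 * D)) powr (1 / (2 - 2 * D))" using s D by (simp add: powr_powr)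
  then have "s * jump_rate D x = (s powr (2 - 2 * D)) powr (1 / (2 - 2 * D)) * (p * x\<^sup>2 / ln x) powr (1 / (2 - 2 * D))"
    by (simp add: jump_rate_def p_def)
  also have "\<dots> = (p * r\<^sup>2 * (l / ln x)) powr (1 / (2 - 2 * D))"
    unfolding sx[symmetric] by (simp only: powr_mult)
  finally have sm: "s * jump_rate D x = (p * r\<^sup>2 * (l / ln x)) powr (1 / (2 - 2 * D))" .
  have "1 / (ln r / l0 + 2) \<le> l / ln x"
  proof -
    have lr: "0 \<le> ln r" using r1 by simp
    have "ln r * 1 \<le> ln r * (l / l0)" using lr l l0 by (intro mult_left_mono) auto
    then have "ln x \<le> l * (ln r / l0 + 2)" using lx_le by (simp add: algebra_simps)
    moreover have "0 < ln r / l0 + 2" using lr l0 by (simp add: add_nonneg_pos)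
    ultimately show ?thesis using lx by (simp add: divide_simps mult.commute)
  qed
  then have "p * r\<^sup>2 * (1 / (ln r / l0 + 2)) \<le> p * r\<^sup>2 * (l / ln x)"
    using p by (intro mult_left_mono) auto
  moreover have "0 \<le> ln r / l0 + 2" using r1 l0 by simp
  ultimately have "(p * r\<^sup>2 / (ln r / l0 + 2)) powr (1 / (2 - 2 * D)) \<le> s * jump_rate D x"
    unfolding sm using p D by (intro powr_mono2) auto
  then show "((1/2 - D) * (1 - D) * r\<^sup>2 / (ln r / l0 + 2)) powr (1 / (2 - 2 * D)) \<le> s * jump_rate D (\<kappa> / s)"
    by (simp add: p_def x_def)
qed

lemma large_deviation_regime_strike_filter:
  assumes D: "0 < D" "D < 1/2" and a: "0 < a" and T: "0 < T" "a * T < 1"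
  shows "large_deviation_regime D (strike_filter D a T) (\<lambda>z. a * snd z) (\<lambda>z. fst z / (a * snd z))"
proof -
  define F where "F = strike_filter D a T"
  define r where "r z = fst z / kappa2 D (a * snd z)" for z :: "real \<times> real"
  define S where "S = a * T"
  define l0 where "l0 = ln (1 / S)"
  have S: "0 < S" "S < 1" using a T by (auto simp: S_def)
  have l0: "0 < l0" using S by (simp add: l0_def)
  have r_top: "filterlim r at_top F"
    unfolding F_def strike_filter_def r_def
    by (rule filterlim_mono[OF filterlim_filtercomap order_refl inf_le1])
  have dom: "eventually (\<lambda>z. 0 < snd z \<and> snd z < T \<and> 0 < fst z) F"
    unfolding F_def strike_filter_def eventually_inf_principal by simp
  have r1: "eventually (\<lambda>z. 1 \<le> r z) F"
    using r_top by (simp add: filterlim_at_top)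
  have "filterlim (\<lambda>y::real. y\<^sup>2 * l0) at_top at_top"
    using l0 by real_asymp
  then have "filterlim (\<lambda>z. (r z)\<^sup>2 * l0) at_top F"
    using r_top by (rule filterlim_compose)
  then have r2: "eventually (\<lambda>z. 1 \<le> (r z)\<^sup>2 * l0) F"
    by (simp add: filterlim_at_top)
  have bounds: "eventually (\<lambda>z. 0 < a * snd z \<and> r z * sqrt l0 \<le> fst z / (a * snd z) \<and>
      ln (1 / (a * snd z)) \<le> ln (fst z / (a * snd z)) / (1 - D) \<and>
      ((1/2 - D) * (1 - D) * (r z)\<^sup>2 / (ln (r z) / l0 + 2)) powr (1 / (2 - 2 * D))
        \<le> a * snd z * jump_rate D (fst z / (a * snd z))) F"
    using dom r1 r2
  proof eventually_elim
    case (elim z)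
    have s: "0 < a * snd z" "a * snd z \<le> S" using elim a by (auto simp: S_def)
    show ?case
      using strike_ratio_bounds[OF D s S(2), of "fst z"] elim s unfolding r_def l0_def by blast
  qed
  have p: "0 < (1/2 - D) * (1 - D)" and e: "0 < 1 / (2 - 2 * D)" using D by auto
  have grow: "filterlim (\<lambda>y::real. (u * y\<^sup>2 / (ln y / l0 + 2)) powr e) at_top at_top"
    if "0 < u" "0 < e" for u e
    using that l0 by real_asymp
  show ?thesis unfolding F_def[symmetric]
  proof
    show "0 < D" "D < 1/2" by fact+
    show "\<forall>\<^sub>F z in F. 0 < a * snd z" using bounds by eventually_elim blast
    show "\<forall>\<^sub>F z in F. ln (1 / (a * snd z)) \<le> ln (fst z / (a * snd z)) / (1 - D)"
      using bounds by eventually_elim blast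
    show "LIM z F. fst z / (a * snd z) :> at_top"
    proof (rule filterlim_at_top_mono)
      have "filterlim (\<lambda>y. y * sqrt l0) at_top at_top" using l0 by real_asymp
      then show "LIM z F. r z * sqrt l0 :> at_top" using r_top by (rule filterlim_compose)
      show "\<forall>\<^sub>F z in F. r z * sqrt l0 \<le> fst z / (a * snd z)" using bounds by eventually_elim blast
    qed
    show "LIM z F. a * snd z * jump_rate D (fst z / (a * snd z)) :> at_top"
      by (rule filterlim_at_top_mono[OF filterlim_compose[OF grow[OF p e] r_top]])
        (use bounds in eventually_elim, blast)
  qed
qed

text \<open>
  A Black-Scholes price with total volatility \<open>v\<close> has the exponent \<open>\<kappa>\<^sup>2 / (2 * v\<^sup>2)\<close>. So the volatility that
  matches the path cost \<open>R\<close> is \<open>\<kappa> / sqrt (2 * R)\<close>, and the constant \<open>C_const\<close> is what turns this into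
  the stated form.
\<close>

lemma smile_asymptote_times_sqrt:
  assumes D: "0 < D" "D < 1/2" and c: "0 < c" and t: "0 < t"
  defines "a \<equiv> c powr (1 / D)"
  assumes x: "1 < \<kappa> / (a * t)"
  shows "smile_asymptote D c \<kappa> t * sqrt t = \<kappa> / sqrt (2 * path_cost D (a * t) (\<kappa> / (a * t)))"
proof -
  define s where "s = a * t"
  define X where "X = \<kappa> / s"
  define y where "y = X\<^sup>2 / ln X"
  define b where "b = 1 / (2 - 2 * D)"
  define e where "e = 1/2 - D"
  define f where "f = 1 - D"
  have a: "0 < a" using c by (simp add: a_def)
  have s: "0 < s" using a t by (simp add: s_def)
  have X: "1 < X" using x by (simp add: X_def s_def)
  have \<kappa>: "\<kappa> = s * X" using s by (simp add: X_def)
  have lX: "0 < ln X" using X by simp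
  have y: "0 < y" using X lX by (simp add: y_def)
  have ef: "0 < e" "0 < f" using D by (auto simp: e_def f_def)
  have exps: "(1/2) / (1 - D) = b" "(1/2 - D) / (1 - D) = 1 - b" using D by (auto simp: b_def field_simps)
  have C: "C_const D = f powr b / e powr (1 - b)" unfolding C_const_def exps e_def f_def ..
  have C0: "0 < C_const D" unfolding C using ef by simp
  have m: "jump_rate D X = e powr b * f powr b * y powr b"
  proof -
    have "jump_rate D X = (e * f * y) powr b" by (simp add: jump_rate_def e_def f_def b_def y_def)
    then show ?thesis using ef y by (simp add: powr_mult)
  qed
  have m0: "0 < jump_rate D X" unfolding m using ef y by simp
  have pw: "((X / sqrt (ln X)) powr (1 - b))\<^sup>2 = y powr (1 - b)"
  proof -
    have "((X / sqrt (ln X)) powr (1 - b))\<^sup>2 = ((X / sqrt (ln X)) * (X / sqrt (ln X))) powr (1 - b)"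
      using X lX by (simp only: power2_eq_square powr_mult)
    also have "(X / sqrt (ln X)) * (X / sqrt (ln X)) = y"
      using lX by (simp add: y_def power2_eq_square)
    finally show ?thesis .
  qed
  have sm: "smile_asymptote D c \<kappa> t = sqrt (a / (2 * C_const D)) * (X / sqrt (ln X)) powr (1 - b)"
    unfolding smile_asymptote_def exps by (simp add: a_def X_def s_def)
  have "(smile_asymptote D c \<kappa> t * sqrt t)\<^sup>2 = s / (2 * C_const D) * y powr (1 - b)"
    unfolding sm power_mult_distrib pw using a t C0 by (simp add: s_def)
  also have "\<dots> = s * e * y / (2 * jump_rate D X)"
  proof -
    have "1 / C_const D = e powr (1 - b) / f powr b" unfolding C by simp
    also have "\<dots> = e / (e powr b * f powr b)" using ef by (simp add: powr_diff)
    finally have "1 / C_const D = e / (e powr b * f powr b)" .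
    then have "s / (2 * C_const D) * y powr (1 - b) = s / 2 * (e / (e powr b * f powr b)) * y powr (1 - b)"
      by (metis (no_types) mult.right_neutral times_divide_eq_right times_divide_times_eq)
    then show ?thesis using y ef unfolding m by (simp add: powr_diff)
  qed
  also have "\<dots> = (\<kappa> / sqrt (2 * path_cost D s X))\<^sup>2"
  proof -
    have "(\<kappa> / sqrt (2 * path_cost D s X))\<^sup>2 = (s * X)\<^sup>2 / (2 * path_cost D s X)"
      using path_cost_pos[OF D s X] unfolding \<kappa> by (simp add: power_divide)
    also have "\<dots> = s * e * y / (2 * jump_rate D X)"
      using s lX m0 ef unfolding path_cost_def e_def[symmetric] y_def by (simp add: power2_eq_square field_simps)
    finally show ?thesis by simp
  qed
  finally have "(smile_asymptote D c \<kappa> t * sqrt t)\<^sup>2 = (\<kappa> / sqrt (2 * path_cost D s X))\<^sup>2" .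
  moreover have "0 \<le> smile_asymptote D c \<kappa> t * sqrt t" unfolding sm using a C0 t by simp
  moreover have "0 \<le> \<kappa> / sqrt (2 * path_cost D s X)"
    using path_cost_pos[OF D s X] s X by (simp add: \<kappa>)
  ultimately show ?thesis unfolding s_def[symmetric] X_def[symmetric] by (simp add: power2_eq_iff_nonneg)
qed

text \<open>
  The intermediate value theorem gives a volatility with the right price, and strict monotonicity
  shows that it is the only one, so that the definite description in \<open>implied_volatility\<close> is
  meaningful.
\<close>

lemma implied_volatility_between:
  assumes P: "prob_space P" and W: "brownian_motion P W" and "0 \<le> \<kappa>" and t: "0 < t"
    and v: "0 < v1" "v1 \<le> v2"
    and price: "bs_price \<kappa> v1 \<le> call_price P X \<kappa> t" "call_price P X \<kappa> t \<le> bs_price \<kappa> v2"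
  shows "v1 \<le> implied_volatility P W X \<kappa> t * sqrt t" "implied_volatility P W X \<kappa> t * sqrt t \<le> v2"
proof -
  have "\<exists>v\<ge>v1. v \<le> v2 \<and> bs_price \<kappa> v = call_price P X \<kappa> t"
    using price v by (intro IVT') (auto intro!: continuous_on_bs_price)
  then obtain v where v12: "v1 \<le> v" "v \<le> v2" and eq: "bs_price \<kappa> v = call_price P X \<kappa> t" by auto
  have v0: "0 < v" using v v12 by simp
  have "implied_volatility P W X \<kappa> t = v / sqrt t"
    unfolding implied_volatility_def
  proof (rule the_equality)
    show "0 < v / sqrt t \<and> call_price P X \<kappa> t = C_BS P W \<kappa> (v / sqrt t * sqrt t)"
      using v0 t eq C_BS_eq_bs_price[OF P W \<open>0 \<le> \<kappa>\<close>, of v] by simp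
    fix \<sigma> assume \<sigma>: "0 < \<sigma> \<and> call_price P X \<kappa> t = C_BS P W \<kappa> (\<sigma> * sqrt t)"
    then have "bs_price \<kappa> (\<sigma> * sqrt t) = bs_price \<kappa> v"
      using t eq C_BS_eq_bs_price[OF P W \<open>0 \<le> \<kappa>\<close>, of "\<sigma> * sqrt t"] by simp
    then have "\<sigma> * sqrt t = v"
      using bs_price_strict_mono[of v "\<sigma> * sqrt t" \<kappa>] bs_price_strict_mono[of "\<sigma> * sqrt t" v \<kappa>] v0 \<sigma> t
      by (cases "\<sigma> * sqrt t" v rule: linorder_cases) auto
    then show "\<sigma> = v / sqrt t" using t by auto
  qed
  then show "v1 \<le> implied_volatility P W X \<kappa> t * sqrt t" "implied_volatility P W X \<kappa> t * sqrt t \<le> v2"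
    using v12 t by simp_all
qed

text \<open>
  Both sides have the path cost as their leading exponent, so a relative change of the volatility by
  \<open>\<epsilon>\<close> outweighs all errors. For each inequality the call price and the Black-Scholes price are
  bounded from opposite sides by explicit expressions, and the comparison of exponents relates these.
\<close>

lemma call_price_between_bs_prices:
  assumes P: "prob_space P" and D: "0 < D" "D < 1/2" and V: "0 < V" and lam: "0 < lam" and tau0: "tau0 < 0"
    and N: "poisson_process P lam N" and W: "brownian_motion P W"
    and indep: "independent_processes P W (time_change D V lam tau0 N)"
    and T: "0 < T" "c_const D V lam powr (1 / D) * T < 1" and \<epsilon>: "0 < \<epsilon>" "\<epsilon> < 1"
  defines "c \<equiv> c_const D V lam"
  shows "eventually (\<lambda>(\<kappa>, t).
      bs_price \<kappa> ((1 - \<epsilon>) * (smile_asymptote D c \<kappa> t * sqrt t))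
        \<le> call_price P (log_price W (time_change D V lam tau0 N)) \<kappa> t \<and>
      call_price P (log_price W (time_change D V lam tau0 N)) \<kappa> t
        \<le> bs_price \<kappa> ((1 + \<epsilon>) * (smile_asymptote D c \<kappa> t * sqrt t)) \<and>
      0 < smile_asymptote D c \<kappa> t) (strike_filter D (c powr (1 / D)) T)"
proof -
  define a where "a = c powr (1 / D)"
  have c: "0 < c" unfolding c_def by (rule c_const_pos[OF P D V lam tau0 N W indep])
  have a: "0 < a" using c by (simp add: a_def)
  have ca: "c = a powr D" using c D by (simp add: a_def powr_powr)
  define F where "F = strike_filter D a T"
  interpret large_deviation_regime D F "\<lambda>z. a * snd z" "\<lambda>z. fst z / (a * snd z)"
    unfolding F_def using D a T by (intro large_deviation_regime_strike_filter) (auto simp: a_def c_def)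
  \<comment> \<open>The exponent, relative to the cost, of the Black-Scholes price at the volatility reduced by \<open>1 - \<epsilon>\<close>.\<close>
  define B where "B = 1 / (1 - \<epsilon>)\<^sup>2"
  have "(1 - \<epsilon>)\<^sup>2 < 1" using \<epsilon> by (simp add: power_less_one_iff abs_square_less_1)
  then have "1 < B" using \<epsilon> by (simp add: B_def)
  then obtain \<delta> where \<delta>: "0 < \<delta>" "\<delta> < 1"
    "(1/2 - D) / (1 - D) + ((1 - \<delta>) powr - D / sqrt (2 * (1 - D)))\<^sup>2 < B"
    by (rule ex_small_gap)
  note lower = lower_exponent_comparison[OF lam a \<delta>]
  note upper = upper_exponent_comparison[OF \<epsilon>(1) lam a]
  have dom: "eventually (\<lambda>z. 0 < snd z \<and> 0 < fst z) F"
    unfolding F_def strike_filter_def eventually_inf_principal by simp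
  have big: "eventually (\<lambda>z. 0 < a * snd z * jump_rate D (fst z / (a * snd z))) F"
    using jumps_at_top by (simp add: filterlim_at_top_dense)
  have "eventually (\<lambda>z.
      bs_price (fst z) ((1 - \<epsilon>) * (smile_asymptote D c (fst z) (snd z) * sqrt (snd z)))
        \<le> call_price P (log_price W (time_change D V lam tau0 N)) (fst z) (snd z) \<and>
      call_price P (log_price W (time_change D V lam tau0 N)) (fst z) (snd z)
        \<le> bs_price (fst z) ((1 + \<epsilon>) * (smile_asymptote D c (fst z) (snd z) * sqrt (snd z))) \<and>
      0 < smile_asymptote D c (fst z) (snd z)) F"
    using lower upper dom big x_gt[of 1] cost_pos
  proof eventually_elim
    case (elim z)
    define \<kappa> t where "\<kappa> = fst z" and "t = snd z"
    define s where "s = a * t"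
    define x where "x = \<kappa> / s"
    define R where "R = path_cost D s x"
    define M where "M = s * jump_rate D x"
    have t: "0 < t" and \<kappa>: "0 < \<kappa>" using elim by (auto simp: t_def \<kappa>_def)
    have s: "0 < s" using a t by (simp add: s_def)
    have x: "1 < x" using elim by (simp add: x_def s_def \<kappa>_def t_def)
    have sx: "s * x = \<kappa>" using s by (simp add: x_def)
    have R: "0 < R" unfolding R_def by (rule path_cost_pos[OF D s x])
    have M: "0 < M" using elim by (simp add: M_def x_def s_def \<kappa>_def t_def)
    have ts: "s / a = t" using a by (simp add: s_def)
    have w: "smile_asymptote D c \<kappa> t * sqrt t = \<kappa> / sqrt (2 * R)"
      using smile_asymptote_times_sqrt[OF D c t, of \<kappa>] x by (simp add: R_def x_def s_def a_def)
    have w0: "0 < \<kappa> / sqrt (2 * R)" using \<kappa> R by simp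
    have smile_pos: "0 < smile_asymptote D c \<kappa> t"
      using w w0 t by (metis zero_less_mult_pos2 real_sqrt_gt_zero)
    define n where "n = nat \<lceil>M\<rceil>"
    define v where "v = a powr D * sqrt n * ((1 - \<delta>) * t / n) powr D"
    note low = elim(1)[folded \<kappa>_def t_def, folded s_def, folded x_def, folded R_def M_def,
        unfolded sx ts, folded n_def, folded v_def]
    note upp = elim(2)[folded \<kappa>_def t_def, folded s_def, folded x_def, folded R_def, unfolded sx ts]
    have "call_price P (log_price W (time_change D V lam tau0 N)) \<kappa> t
        \<le> bs_price \<kappa> ((1 + \<epsilon>) * (\<kappa> / sqrt (2 * R)))"
    proof -
      have "c\<^sup>2 * t powr (2 * D) = s powr (2 * D)"
        using a t by (simp add: ca s_def powr_mult power2_eq_square powr_add[symmetric])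
      then have A: "\<kappa>\<^sup>2 / (2 * c\<^sup>2 * t powr (2 * D)) = (s * x)\<^sup>2 / (2 * s powr (2 * D))"
        by (simp add: sx mult.assoc)
      have "call_price P (log_price W (time_change D V lam tau0 N)) \<kappa> t
          \<le> exp (\<kappa> / 2 - R + ln x / (1 - D) + lam * t * (exp (ln x / (1 - D)) - 1))"
        using call_price_le[OF P D V lam tau0 N W indep t less_imp_le[OF \<kappa>] M]
        unfolding c_def[symmetric] A M_def chernoff_exponent[OF D s x] R_def .
      also note upp
      also have "(1 + \<epsilon>) * (\<kappa> / sqrt (2 * R)) * std_normal_density
          (\<kappa> / ((1 + \<epsilon>) * (\<kappa> / sqrt (2 * R))) + (1 + \<epsilon>) * (\<kappa> / sqrt (2 * R)) / 2 + 2)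
          \<le> bs_price \<kappa> ((1 + \<epsilon>) * (\<kappa> / sqrt (2 * R)))"
        using w0 \<epsilon> \<kappa> by (intro bs_price_ge mult_pos_pos) auto
      finally show ?thesis .
    qed
    moreover have "bs_price \<kappa> ((1 - \<epsilon>) * (\<kappa> / sqrt (2 * R)))
        \<le> call_price P (log_price W (time_change D V lam tau0 N)) \<kappa> t"
    proof -
      have "bs_price \<kappa> ((1 - \<epsilon>) * (\<kappa> / sqrt (2 * R)))
          \<le> exp (\<kappa> / 2 - \<kappa>\<^sup>2 / (2 * ((1 - \<epsilon>) * (\<kappa> / sqrt (2 * R)))\<^sup>2))"
        using w0 \<epsilon> \<kappa> by (intro bs_price_le_exp mult_pos_pos) auto
      also have "\<kappa>\<^sup>2 / (2 * ((1 - \<epsilon>) * (\<kappa> / sqrt (2 * R)))\<^sup>2) = B * R"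
        using \<kappa> R by (simp add: B_def power_mult_distrib power_divide)
      also note low
      also have "exp (- lam * t) * (lam * \<delta> * t / n) ^ n * (v * std_normal_density (\<kappa> / v + v / 2 + 2))
          \<le> call_price P (log_price W (time_change D V lam tau0 N)) \<kappa> t"
        unfolding v_def ca[symmetric] c_def
        by (rule call_price_ge[OF P D V lam tau0 N W indep t less_imp_le[OF \<kappa>] _ \<delta>(1,2)])
          (use M in \<open>simp add: n_def\<close>)
      finally show ?thesis .
    qed
    ultimately show ?case
      using smile_pos unfolding \<kappa>_def[symmetric] t_def[symmetric] w by blast
  qed
  then show ?thesis unfolding F_def a_def by (simp add: case_prod_unfold)
qed

theorem corollary3p6:
  fixes P :: "'a measure"
    and N :: "real \<Rightarrow> 'a \<Rightarrow> nat"
    and W I X :: "real \<Rightarrow> 'a \<Rightarrow> real"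
    and D V lam tau0 c T :: real
  defines "c \<equiv> c_const D V lam"
    and "I \<equiv> time_change D V lam tau0 N"
    and "X \<equiv> log_price W I"
  assumes "prob_space P"
    and "0 < D" and "D < 1/2" and "0 < V" and "0 < lam" and "tau0 < 0"
    and "poisson_process P lam N"
    and "brownian_motion P W"
    and "independent_processes P W I"
    and "0 < T"
    and kappa2_domain: "c powr (1 / D) * T < 1"
  shows "\<forall>\<epsilon>>0. \<exists>M>0. \<forall>(\<kappa>, t) \<in> A_set D c T M.
           (1 - \<epsilon>) * smile_asymptote D c \<kappa> t \<le> implied_volatility P W X \<kappa> t \<and>
           implied_volatility P W X \<kappa> t \<le> (1 + \<epsilon>) * smile_asymptote D c \<kappa> t"
proof (intro allI impI)
  fix \<epsilon> :: real assume \<epsilon>: "0 < \<epsilon>"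
  \<comment> \<open>For \<open>\<epsilon> \<ge> 1\<close> the lower bound is not a volatility, so the bounds are proved for a smaller tolerance.\<close>
  define e where "e = min \<epsilon> (1/2)"
  have e: "0 < e" "e < 1" "e \<le> \<epsilon>" using \<epsilon> by (auto simp: e_def)
  define a where "a = c powr (1 / D)"
  have indep: "independent_processes P W (time_change D V lam tau0 N)"
    using \<open>independent_processes P W I\<close> by (simp add: I_def)
  note model = \<open>prob_space P\<close> \<open>0 < D\<close> \<open>D < 1/2\<close> \<open>0 < V\<close> \<open>0 < lam\<close> \<open>tau0 < 0\<close>
    \<open>poisson_process P lam N\<close> \<open>brownian_motion P W\<close> indep
  have a: "0 < a" using c_const_pos[OF model] by (simp add: a_def c_def)
  have ev: "eventually (\<lambda>(\<kappa>, t). bs_price \<kappa> ((1 - e) * (smile_asymptote D c \<kappa> t * sqrt t)) \<le> call_price P X \<kappa> t \<and>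
      call_price P X \<kappa> t \<le> bs_price \<kappa> ((1 + e) * (smile_asymptote D c \<kappa> t * sqrt t)) \<and>
      0 < smile_asymptote D c \<kappa> t) (strike_filter D a T)"
    unfolding X_def I_def a_def c_def
    by (rule call_price_between_bs_prices[OF model \<open>0 < T\<close> kappa2_domain[unfolded c_def] e(1,2)])
  obtain M where M: "0 < M" and prices: "\<And>\<kappa> t. 0 < t \<Longrightarrow> t < T \<Longrightarrow> M * kappa2 D (a * t) < \<kappa> \<Longrightarrow>
      0 < \<kappa> \<and> bs_price \<kappa> ((1 - e) * (smile_asymptote D c \<kappa> t * sqrt t)) \<le> call_price P X \<kappa> t \<and>
      call_price P X \<kappa> t \<le> bs_price \<kappa> ((1 + e) * (smile_asymptote D c \<kappa> t * sqrt t)) \<and>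
      0 < smile_asymptote D c \<kappa> t"
    using eventually_strike_filterD[OF ev a] kappa2_domain by (auto simp: a_def)
  have "(1 - \<epsilon>) * smile_asymptote D c \<kappa> t \<le> implied_volatility P W X \<kappa> t \<and>
      implied_volatility P W X \<kappa> t \<le> (1 + \<epsilon>) * smile_asymptote D c \<kappa> t"
    if "(\<kappa>, t) \<in> A_set D c T M" for \<kappa> t
  proof -
    define \<sigma> where "\<sigma> = smile_asymptote D c \<kappa> t"
    have t: "0 < t" "t < T" "M * kappa2 D (a * t) < \<kappa>" using that by (auto simp: A_set_def a_def)
    note p = prices[OF t, folded \<sigma>_def]
    have "0 < (1 - e) * (\<sigma> * sqrt t)" using p e t by simp
    moreover have "(1 - e) * (\<sigma> * sqrt t) \<le> (1 + e) * (\<sigma> * sqrt t)"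
      using p e t by (intro mult_right_mono) auto
    ultimately have "(1 - e) * (\<sigma> * sqrt t) \<le> implied_volatility P W X \<kappa> t * sqrt t"
      "implied_volatility P W X \<kappa> t * sqrt t \<le> (1 + e) * (\<sigma> * sqrt t)"
      using implied_volatility_between[OF \<open>prob_space P\<close> \<open>brownian_motion P W\<close> _ t(1), of \<kappa>
        "(1 - e) * (\<sigma> * sqrt t)" "(1 + e) * (\<sigma> * sqrt t)" X] p by auto
    then have "(1 - e) * \<sigma> \<le> implied_volatility P W X \<kappa> t" "implied_volatility P W X \<kappa> t \<le> (1 + e) * \<sigma>"
      using t by (simp_all add: mult.assoc[symmetric])
    moreover have "(1 - \<epsilon>) * \<sigma> \<le> (1 - e) * \<sigma>" "(1 + e) * \<sigma> \<le> (1 + \<epsilon>) * \<sigma>"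
      using p e by (auto intro!: mult_right_mono)
    ultimately show ?thesis unfolding \<sigma>_def by linarith
  qed
  then show "\<exists>M>0. \<forall>(\<kappa>, t) \<in> A_set D c T M.
      (1 - \<epsilon>) * smile_asymptote D c \<kappa> t \<le> implied_volatility P W X \<kappa> t \<and>
      implied_volatility P W X \<kappa> t \<le> (1 + \<epsilon>) * smile_asymptote D c \<kappa> t"
    using M by blast
qed

end
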